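(* For every $s\in(0,\infty)$ there exist constants $0<k_s\le K_s<\infty$ such that for every integer $d\ge1$ and every $f\in L^2([-\pi,\pi],\mathbb R^d)$ with Fourier coefficients $\{c_n\}$, setting $$L(f):=\int_{-\pi}^{\pi}\int_{-\pi}^{\pi}\frac{|f(u)-f(v)|^2}{|\sin\frac{u-v}2|}\Big(\log_2\frac{\pi}{|\sin\frac{u-v}2|}\Big)^{2s-1}du\,dv,\qquad l(f):=\sum_{n=0}^\infty(\log_2(n+1))^{2s}|c_n|^2,$$ one has $$k_s\,l(f)\le L(f)\le K_s\,l(f).$$
   Context: For $f=(f_1,\dots,f_d)$, the Fourier coefficients are $c_n=(c_n^1,\dots,c_n^d)\in\mathbb C^d\cong\mathbb R^{2d}$ with $c_n^k=\int_{-\pi}^\pi f_k(\theta)e^{in\theta}d\theta$. $|\cdot|$ is the Euclidean norm. $L(f)$ and $l(f)$ take values in $[0,\infty]$. *)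

theory Defs
  imports "HOL-Analysis.Analysis"
begin

text \<open>
  The dimension \<open>d\<close> is quantified inside the main statement, below the constants, so it
  cannot be a type. A function with values in \<open>\<real>\<^sup>d\<close> is therefore a function
  \<open>f :: real \<Rightarrow> nat \<Rightarrow> real\<close> of which only the components \<open>f \<theta> k\<close> with
  \<open>k \<in> {1..d}\<close> are used, and the Euclidean norm is \<open>L2_set\<close> over \<open>{1..d}\<close>.
\<close>

abbreviation circle_measure :: "real measure" where
  "circle_measure \<equiv> lebesgue_on {-pi..pi}"

definition in_L2 :: "nat \<Rightarrow> (real \<Rightarrow> nat \<Rightarrow> real) \<Rightarrow> bool" where
  "in_L2 d f \<longleftrightarrow>
     (\<forall>k\<in>{1..d}. (\<lambda>\<theta>. f \<theta> k) \<in> borel_measurable circle_measure) \<and>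
     integrable circle_measure (\<lambda>\<theta>. (L2_set (f \<theta>) {1..d})\<^sup>2)"

text \<open>The coefficients are not normalised, and the exponent has a positive sign.\<close>

definition fourier_coeff :: "(real \<Rightarrow> nat \<Rightarrow> real) \<Rightarrow> nat \<Rightarrow> nat \<Rightarrow> complex" where
  "fourier_coeff f n k =
     (LINT \<theta>|circle_measure. complex_of_real (f \<theta> k) * exp (\<i> * of_nat n * of_real \<theta>))"

text \<open>
  The singular set \<open>sin ((u - v) / 2) = 0\<close> is a null set, where the integrand below is \<open>0\<close>
  because of division by zero. Elsewhere the logarithm exceeds \<open>1\<close>, so \<open>powr\<close> is the
  usual real power.
\<close>

definition L_energy :: "real \<Rightarrow> nat \<Rightarrow> (real \<Rightarrow> nat \<Rightarrow> real) \<Rightarrow> ennreal" where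
  "L_energy s d f =
     (\<integral>\<^sup>+v. \<integral>\<^sup>+u. ennreal
        ((L2_set (\<lambda>k. f u k - f v k) {1..d})\<^sup>2 / \<bar>sin ((u - v) / 2)\<bar>
          * (log 2 (pi / \<bar>sin ((u - v) / 2)\<bar>)) powr (2 * s - 1))
      \<partial>circle_measure \<partial>circle_measure)"

text \<open>For \<open>n = 0\<close> the weight is \<open>0 powr (2 * s) = 0\<close>.\<close>

definition l_energy :: "real \<Rightarrow> nat \<Rightarrow> (real \<Rightarrow> nat \<Rightarrow> real) \<Rightarrow> ennreal" where
  "l_energy s d f =
     (\<Sum>n. ennreal ((log 2 (real n + 1)) powr (2 * s)
        * (L2_set (\<lambda>k. cmod (fourier_coeff f n k)) {1..d})\<^sup>2))"

end

theory Submission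
  imports Defs
begin

text \<open>
  The energy \<open>L\<close> is diagonal in Fourier space. Substituting \<open>u = v + t\<close> in the periodic double
  integral turns it into \<open>\<integral> \<phi>(t) (\<integral> |f(v + t) - f(v)|\<^sup>2 dv) dt\<close>, where \<open>\<phi>(t)\<close> is the kernel
  \<open>log_kernel s t\<close>. Translation by \<open>t\<close> multiplies the \<open>n\<close>-th coefficient by \<open>exp (-i n t)\<close>, so
  Parseval's identity gives \<open>(4 / \<pi>) \<Sum>n. |c\<^sub>n|\<^sup>2 sin\<^sup>2 (n t / 2)\<close> for the inner integral
  (\<open>nn_integral_translation_difference\<close>), and Tonelli's theorem yields the exact formula
  \<open>L(f) = (4 / \<pi>) \<Sum>n. |c\<^sub>n|\<^sup>2 \<Phi>(n)\<close> with the multiplier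
  \<open>\<Phi>(n) = \<integral> \<phi>(t) sin\<^sup>2 (n t / 2) dt\<close> (\<open>L_energy_eq_multiplier_sum\<close>). All terms are nonnegative,
  so these manipulations are valid even when both sides are infinite, and the theorem
  becomes the statement that \<open>\<Phi>(n)\<close> is comparable to \<open>log 2 (n + 1) powr (2 s)\<close> for
  \<open>n \<ge> 1\<close>, with constants depending on \<open>s\<close> only (\<open>multiplier_upper\<close>, \<open>multiplier_lower\<close>).

  For the multiplier, \<open>\<phi>(t)\<close> is comparable on \<open>(0, \<pi>]\<close> to \<open>\<psi>(t) = \<ell>(t) powr (2 s - 1) / t\<close> with
  \<open>\<ell>(t) = log 2 (2 \<pi> / t)\<close>, and \<open>\<psi>\<close> has the elementary antiderivative
  \<open>- (ln 2 / (2 s)) \<ell>(t) powr (2 s)\<close>. The range \<open>t \<ge> 1 / n\<close> thus contributes at most a multiple of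
  \<open>\<ell>(1 / n) powr (2 s)\<close>, while for \<open>t \<le> 1 / n\<close> the bound \<open>sin\<^sup>2 (n t / 2) \<le> n\<^sup>2 t\<^sup>2\<close> absorbs the
  singularity. From below, the translation \<open>t \<mapsto> t + \<pi> / n\<close> exchanges \<open>sin\<^sup>2 (n t / 2)\<close> with
  \<open>cos\<^sup>2 (n t / 2)\<close> and changes \<open>\<psi>\<close> by a bounded factor only, so the oscillating factor loses no
  more than a constant.

  Parseval's identity (\<open>Parseval_real\<close>) follows from the density of trigonometric polynomials in
  \<open>L\<^sup>2\<close> of the circle: the Stone-Weierstrass theorem on the unit circle handles continuous
  functions, and dominated limits lead from there to all square integrable functions. To use the
  substitution \<open>u = v + t\<close>, each component of \<open>f\<close> is first replaced by an almost everywhere equal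
  Borel function of period \<open>2 \<pi>\<close>.
\<close>

section \<open>The circle and orthogonality of characters\<close>

lemma borel_measurable_circle:
  "f \<in> borel_measurable borel \<Longrightarrow> f \<in> borel_measurable circle_measure"
  for f :: "real \<Rightarrow> 'b::topological_space"
  by (intro measurable_restrict_space1 measurable_completion) simp

lemma finite_measure_circle: "finite_measure circle_measure"
  by (rule finite_measure_lebesgue_on) simp

lemma integrable_circle_bounded:
  fixes f :: "real \<Rightarrow> 'b::{banach, second_countable_topology}"
  assumes "f \<in> borel_measurable borel" "\<And>x. norm (f x) \<le> B"
  shows "integrable circle_measure f"
  using finite_measure.integrable_const_bound[OF finite_measure_circle, of f B] assms
    borel_measurable_circle[OF assms(1)] by simp

lemma integrable_circle_cis_mult:
  assumes "integrable circle_measure g"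
  shows "integrable circle_measure (\<lambda>t. complex_of_real (g t) * cis (c * t))"
proof (rule Bochner_Integration.integrable_bound[OF assms])
  have "(\<lambda>t. cis (c * t)) \<in> borel_measurable circle_measure"
    by (intro borel_measurable_circle borel_measurable_continuous_onI continuous_intros)
  then show "(\<lambda>t. complex_of_real (g t) * cis (c * t)) \<in> borel_measurable circle_measure"
    using borel_measurable_integrable[OF assms] by simp
qed (simp add: norm_mult)

lemma integrable_of_square_integrable:
  assumes [measurable]: "g \<in> borel_measurable circle_measure"
    and "integrable circle_measure (\<lambda>t. (g t)\<^sup>2)"
  shows "integrable circle_measure (g :: real \<Rightarrow> real)"
proof (rule Bochner_Integration.integrable_bound)
  show "integrable circle_measure (\<lambda>t. 1 + (g t)\<^sup>2)"
    using assms integrable_circle_bounded[of "\<lambda>_. 1::real" 1] by simp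
  have "\<bar>x\<bar> \<le> 1 + x\<^sup>2" for x :: real
    using zero_le_power2[of "\<bar>x\<bar> - 1"] by (auto simp: power2_eq_square algebra_simps)
  then show "AE t in circle_measure. norm (g t) \<le> norm (1 + (g t)\<^sup>2)"
    by (auto intro!: always_eventually simp: abs_of_nonneg)
qed simp

lemma integral_circle_cis:
  "(LINT t|circle_measure. cis (of_int k * t)) = (if k = 0 then complex_of_real (2 * pi) else 0)"
proof -
  have m: "(\<lambda>t. cis (of_int k * t)) \<in> borel_measurable borel"
    by (intro borel_measurable_continuous_onI continuous_intros)
  have i: "integrable circle_measure (\<lambda>t. cis (of_int k * t))"
    by (rule integrable_circle_bounded[OF m, of 1]) simp
  have e: "(LINT t|circle_measure. cis (of_int k * t)) = integral {-pi..pi} (\<lambda>t. cis (of_int k * t))"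
    by (rule lebesgue_integral_eq_integral[OF i]) simp
  show ?thesis
  proof (cases "k = 0")
    case True
    then show ?thesis using e by (simp add: scaleR_conv_of_real)
  next
    case False
    have "((\<lambda>t. cis (of_int k * t)) has_integral
        cis (of_int k * pi) / (\<i> * of_int k) - cis (of_int k * (-pi)) / (\<i> * of_int k)) {-pi..pi}"
    proof (rule fundamental_theorem_of_calculus)
      fix x
      have "((\<lambda>z. exp (\<i> * of_int k * z) / (\<i> * of_int k)) has_field_derivative
          exp (\<i> * of_int k * complex_of_real x)) (at (complex_of_real x))"
        using False by (auto intro!: derivative_eq_intros)
      from has_vector_derivative_real_field[OF this]
      show "((\<lambda>t. cis (of_int k * t) / (\<i> * of_int k)) has_vector_derivative cis (of_int k * x))
          (at x within {-pi..pi})"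
        by (simp add: cis_conv_exp mult_ac)
    qed simp
    moreover have "cis (of_int k * pi) = cis (of_int k * (-pi))"
    proof -
      have "cis (of_int k * pi) = cis (of_int k * (-pi)) * cis (2 * pi * of_int k)"
        by (simp add: cis_mult algebra_simps)
      then show ?thesis by (simp add: cis_multiple_2pi)
    qed
    ultimately show ?thesis using e False by (simp add: integral_unique)
  qed
qed

text \<open>
  Completing the square in the coefficients. The choice \<open>a k = \<gamma> k / (2 * pi)\<close> gives Bessel's
  inequality; an arbitrary choice shows that any approximating polynomial bounds the defect in
  Parseval's identity.
\<close>

lemma square_distance_trig_poly:
  fixes g :: "real \<Rightarrow> real" and K :: "int set" and a \<gamma> :: "int \<Rightarrow> complex"
  assumes g: "g \<in> borel_measurable circle_measure" "integrable circle_measure (\<lambda>t. (g t)\<^sup>2)"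
    and K: "finite K"
  defines "\<gamma> \<equiv> \<lambda>k. (LINT t|circle_measure. complex_of_real (g t) * cis (- of_int k * t))"
  shows "(LINT t|circle_measure. (cmod (g t - (\<Sum>k\<in>K. a k * cis (of_int k * t))))\<^sup>2)
    = (LINT t|circle_measure. (g t)\<^sup>2) - (\<Sum>k\<in>K. (cmod (\<gamma> k))\<^sup>2) / (2 * pi)
      + 2 * pi * (\<Sum>k\<in>K. (cmod (a k - \<gamma> k / (2 * pi)))\<^sup>2)"
proof -
  let ?E = "\<lambda>t. \<Sum>k\<in>K. a k * cis (of_int k * t)"
  have ig: "integrable circle_measure g"
    using integrable_of_square_integrable g by blast
  have ic: "integrable circle_measure (\<lambda>t. cis (c * t))" for c
    by (rule integrable_circle_bounded[of _ 1])
      (auto intro!: borel_measurable_continuous_onI continuous_intros)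
  note igc = integrable_circle_cis_mult[OF ig]
  have cnj\<gamma>: "(LINT t|circle_measure. complex_of_real (g t) * cis (of_int k * t)) = cnj (\<gamma> k)" for k
  proof -
    have e: "complex_of_real (g t) * cis (of_int k * t) = cnj (complex_of_real (g t) * cis (- of_int k * t))" for t
      by (simp add: cis_cnj)
    show ?thesis unfolding \<gamma>_def e by (rule Bochner_Integration.integral_cnj)
  qed
  have 1: "complex_of_real ((cmod (g t - ?E t))\<^sup>2)
     = complex_of_real ((g t)\<^sup>2)
       - (\<Sum>k\<in>K. cnj (a k) * (g t * cis (- of_int k * t)))
       - (\<Sum>k\<in>K. a k * (g t * cis (of_int k * t)))
       + (\<Sum>j\<in>K. \<Sum>k\<in>K. a j * cnj (a k) * cis (of_int (j - k) * t))" for t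
  proof -
    have "complex_of_real ((cmod (g t - ?E t))\<^sup>2) = (g t - ?E t) * cnj (g t - ?E t)"
      by (simp only: complex_norm_square)
    also have "\<dots> = g t * g t - g t * cnj (?E t) - g t * ?E t + ?E t * cnj (?E t)"
      by (simp add: algebra_simps)
    also have "g t * cnj (?E t) = (\<Sum>k\<in>K. cnj (a k) * (g t * cis (- of_int k * t)))"
      by (simp add: sum_distrib_left cis_cnj mult_ac)
    also have "g t * ?E t = (\<Sum>k\<in>K. a k * (g t * cis (of_int k * t)))"
      by (simp add: sum_distrib_left mult_ac)
    also have "?E t * cnj (?E t) = (\<Sum>j\<in>K. \<Sum>k\<in>K. a j * cnj (a k) * cis (of_int (j - k) * t))"
    proof -
      have c: "cis (of_int (j - k) * t) = cis (of_int j * t) * cis (- (of_int k * t))" for j k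
        by (simp add: cis_mult algebra_simps)
      show ?thesis unfolding c by (simp add: cis_cnj sum_product mult_ac)
    qed
    finally show ?thesis by (simp add: power2_eq_square)
  qed
  have "complex_of_real (LINT t|circle_measure. (cmod (g t - ?E t))\<^sup>2)
     = (LINT t|circle_measure. complex_of_real ((cmod (g t - ?E t))\<^sup>2))"
    by (rule integral_complex_of_real[symmetric])
  also have "\<dots> = complex_of_real (LINT t|circle_measure. (g t)\<^sup>2)
       - (\<Sum>k\<in>K. cnj (a k) * \<gamma> k) - (\<Sum>k\<in>K. a k * cnj (\<gamma> k))
       + (\<Sum>j\<in>K. \<Sum>k\<in>K. a j * cnj (a k) * (if j - k = 0 then complex_of_real (2 * pi) else 0))"
    unfolding 1
  proof (rule has_bochner_integral_integral_eq, intro has_bochner_integral_add has_bochner_integral_diff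
      has_bochner_integral_sum has_bochner_integral_mult_right)
    show "has_bochner_integral circle_measure (\<lambda>t. complex_of_real ((g t)\<^sup>2))
        (complex_of_real (LINT t|circle_measure. (g t)\<^sup>2))"
      using g(2) by (intro has_bochner_integral_of_real has_bochner_integral_integrable)
    show "has_bochner_integral circle_measure (\<lambda>t. complex_of_real (g t) * cis (- of_int k * t)) (\<gamma> k)" for k
      unfolding \<gamma>_def by (rule has_bochner_integral_integrable[OF igc])
    show "has_bochner_integral circle_measure (\<lambda>t. complex_of_real (g t) * cis (of_int k * t)) (cnj (\<gamma> k))" for k
      unfolding cnj\<gamma>[symmetric] by (rule has_bochner_integral_integrable[OF igc])
    show "has_bochner_integral circle_measure (\<lambda>t. cis (of_int (j - k) * t))
        (if j - k = 0 then complex_of_real (2 * pi) else 0)" for j k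
      unfolding integral_circle_cis[symmetric] by (rule has_bochner_integral_integrable[OF ic])
  qed
  also have "(\<Sum>j\<in>K. \<Sum>k\<in>K. a j * cnj (a k) * (if j - k = 0 then complex_of_real (2 * pi) else 0))
      = (\<Sum>k\<in>K. 2 * pi * (a k * cnj (a k)))"
    using K by (intro sum.cong refl) (simp add: if_distrib[of "\<lambda>x. _ * x"] sum.delta mult_ac cong: if_cong)
  also have "complex_of_real (LINT t|circle_measure. (g t)\<^sup>2)
       - (\<Sum>k\<in>K. cnj (a k) * \<gamma> k) - (\<Sum>k\<in>K. a k * cnj (\<gamma> k)) + (\<Sum>k\<in>K. 2 * pi * (a k * cnj (a k)))
     = complex_of_real (LINT t|circle_measure. (g t)\<^sup>2) +
       (\<Sum>k\<in>K. 2 * pi * (a k * cnj (a k)) - cnj (a k) * \<gamma> k - a k * cnj (\<gamma> k))"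
    by (simp add: sum_subtractf)
  also have "(\<Sum>k\<in>K. 2 * pi * (a k * cnj (a k)) - cnj (a k) * \<gamma> k - a k * cnj (\<gamma> k))
     = (\<Sum>k\<in>K. complex_of_real (2 * pi) * complex_of_real ((cmod (a k - \<gamma> k / (2 * pi)))\<^sup>2)
        - complex_of_real ((cmod (\<gamma> k))\<^sup>2) / complex_of_real (2 * pi))"
  proof (rule sum.cong)
    fix k
    show "2 * pi * (a k * cnj (a k)) - cnj (a k) * \<gamma> k - a k * cnj (\<gamma> k) =
      complex_of_real (2 * pi) * complex_of_real ((cmod (a k - \<gamma> k / (2 * pi)))\<^sup>2)
        - complex_of_real ((cmod (\<gamma> k))\<^sup>2) / complex_of_real (2 * pi)"
      by (simp only: complex_norm_square of_real_mult) (simp add: field_simps power2_eq_square)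
  qed simp
  also have "complex_of_real (LINT t|circle_measure. (g t)\<^sup>2) + \<dots>
     = of_real ((LINT t|circle_measure. (g t)\<^sup>2) - (\<Sum>k\<in>K. (cmod (\<gamma> k))\<^sup>2) / (2 * pi)
      + 2 * pi * (\<Sum>k\<in>K. (cmod (a k - \<gamma> k / (2 * pi)))\<^sup>2))"
    by (simp add: sum_subtractf sum_distrib_left sum_divide_distrib)
  finally show ?thesis by (simp only: of_real_eq_iff)
qed

section \<open>Uniform approximation by trigonometric polynomials\<close>

text \<open>
  Frequencies are integers of both signs, so that products of real trigonometric polynomials stay
  in the class.
\<close>

inductive trig_poly :: "(real \<Rightarrow> complex) \<Rightarrow> bool" where
  monomial: "trig_poly (\<lambda>t. c * cis (of_int k * t))"
| add: "trig_poly p \<Longrightarrow> trig_poly q \<Longrightarrow> trig_poly (\<lambda>t. p t + q t)"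

lemma trig_poly_mult:
  assumes "trig_poly p" "trig_poly q"
  shows "trig_poly (\<lambda>t. p t * q t)"
  using assms
proof (induction p)
  case (monomial c k)
  from monomial show ?case
  proof (induction q)
    case (monomial d l)
    have "c * cis (of_int k * t) * (d * cis (of_int l * t)) = c * d * cis (of_int (k + l) * t)" for t
      by (simp add: cis_mult algebra_simps flip: cis_mult)
    then show ?case by (simp only: trig_poly.monomial)
  next
    case (add p q)
    then show ?case by (simp only: distrib_left trig_poly.add)
  qed
next
  case (add p q)
  then show ?case by (simp only: distrib_right trig_poly.add)
qed

text \<open>
  One coefficient function serves every large cutoff \<open>M\<close>, which lets the approximation be compared
  with all late partial sums at once.
\<close>

lemma trig_poly_finite_sum:
  assumes "trig_poly p"
  shows "\<exists>a::int \<Rightarrow> complex. \<exists>N. \<forall>M\<ge>N. \<forall>t. p t = (\<Sum>k\<in>{-int M..int M}. a k * cis (of_int k * t))"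
  using assms
proof induction
  case (monomial c k)
  have "c * cis (of_int k * t) = (\<Sum>j\<in>{-int M..int M}. (if j = k then c else 0) * cis (of_int j * t))"
    if "M \<ge> nat \<bar>k\<bar>" for M t
  proof -
    have "k \<in> {-int M..int M}" using that by auto
    then show ?thesis by (simp add: if_distrib[of "\<lambda>x. x * _"] cong: if_cong)
  qed
  then show ?case by (intro exI[of _ "\<lambda>j. if j = k then c else 0"] exI[of _ "nat \<bar>k\<bar>"] allI impI)
next
  case (add p q)
  from add.IH(1) obtain a N where
    p: "\<forall>M\<ge>N. \<forall>t. p t = (\<Sum>k\<in>{-int M..int M}. a k * cis (of_int k * t))" by (elim exE) (rule that)
  from add.IH(2) obtain b N' where
    q: "\<forall>M\<ge>N'. \<forall>t. q t = (\<Sum>k\<in>{-int M..int M}. b k * cis (of_int k * t))" by (elim exE) (rule that)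
  have "p t + q t = (\<Sum>k\<in>{-int M..int M}. (a k + b k) * cis (of_int k * t))" if "M \<ge> max N N'" for M t
    using that p[rule_format, of M t] q[rule_format, of M t] by (simp add: sum.distrib distrib_right)
  then show ?case by (intro exI[of _ "\<lambda>k. a k + b k"] exI[of _ "max N N'"] allI impI)
qed

text \<open>
  A real-linear functional of \<open>cis t\<close> is a combination of \<open>cos t\<close> and \<open>sin t\<close>, and the class is
  closed under sums and products.
\<close>

lemma trig_poly_real_polynomial_function:
  fixes r :: "complex \<Rightarrow> real"
  assumes "real_polynomial_function r"
  shows "trig_poly (\<lambda>t. complex_of_real (r (cis t)))"
  using assms
proof induction
  case (linear f)
  then interpret bounded_linear f .
  have "complex_of_real (f (cis t)) = ((f 1 - \<i> * f \<i>) / 2) * cis (of_int 1 * t)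
      + ((f 1 + \<i> * f \<i>) / 2) * cis (of_int (-1) * t)" for t
  proof -
    have "cis t = cos t *\<^sub>R 1 + sin t *\<^sub>R \<i>" by (simp add: complex_eq_iff)
    then have "f (cis t) = cos t * f 1 + sin t * f \<i>" by (simp only: add scaleR real_scaleR_def)
    then show ?thesis by (simp add: complex_eq_iff field_simps)
  qed
  then show ?case by (simp only: trig_poly.add trig_poly.monomial)
next
  case (const c)
  show ?case using monomial[of "of_real c" 0] by simp
qed (simp_all add: trig_poly.add trig_poly_mult)

text \<open>
  The function is transported to the unit circle, where the Stone-Weierstrass theorem provides a
  polynomial in the real and imaginary parts.
\<close>

lemma continuous_periodic_trig_poly_approx:
  fixes h :: "real \<Rightarrow> real"
  assumes h: "continuous_on {-pi..pi} h" "h (- pi) = h pi" and "e > 0"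
  obtains p where "trig_poly p" "\<And>t. t \<in> {-pi..pi} \<Longrightarrow> cmod (complex_of_real (h t) - p t) < e"
proof -
  let ?S = "sphere (0::complex) 1"
  \<comment> \<open>The angle is \<open>arccos (Re z)\<close> on the closed upper half circle and its negative on the lower one.
     The two branches agree at \<open>1\<close>, and at \<open>- 1\<close> because \<open>h (- pi) = h pi\<close>, so they glue.\<close>
  define H where "H = (\<lambda>z. if 0 \<le> Im z then h (arccos (Re z)) else h (- arccos (Re z)))"
  have Re: "\<bar>Re z\<bar> \<le> 1" if "z \<in> ?S" for z using that abs_Re_le_cmod[of z] by simp
  have ac: "continuous_on ?S (\<lambda>z. arccos (Re z))"
    by (rule continuous_on_compose2[OF continuous_on_arccos'])
      (use Re in \<open>auto intro!: continuous_intros simp: abs_le_iff\<close>)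
  have im: "arccos (Re z) \<in> {0..pi}" if "z \<in> ?S" for z
    using arccos_bounded[of "Re z"] Re[OF that] by auto
  have "continuous_on ((?S \<inter> {z. 0 \<le> Im z}) \<union> (?S \<inter> {z. Im z \<le> 0})) H"
    unfolding H_def
  proof (rule continuous_on_cases)
    show "closed (?S \<inter> {z. 0 \<le> Im z})" "closed (?S \<inter> {z. Im z \<le> 0})"
      by (intro closed_Int closed_sphere closed_halfspace_Im_ge closed_halfspace_Im_le)+
    show "continuous_on (?S \<inter> {z. 0 \<le> Im z}) (\<lambda>z. h (arccos (Re z)))"
      by (rule continuous_on_compose2[OF h(1) continuous_on_subset[OF ac]])
        (use im in fastforce)+
    show "continuous_on (?S \<inter> {z. Im z \<le> 0}) (\<lambda>z. h (- arccos (Re z)))"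
      by (rule continuous_on_compose2[OF h(1) continuous_on_minus[OF continuous_on_subset[OF ac]]])
        (use im in fastforce)+
    show "\<forall>z. z \<in> ?S \<inter> {z. 0 \<le> Im z} \<and> \<not> 0 \<le> Im z \<or> z \<in> ?S \<inter> {z. Im z \<le> 0} \<and> 0 \<le> Im z
        \<longrightarrow> h (arccos (Re z)) = h (- arccos (Re z))"
    proof (intro allI impI)
      fix z assume "z \<in> ?S \<inter> {z. 0 \<le> Im z} \<and> \<not> 0 \<le> Im z \<or> z \<in> ?S \<inter> {z. Im z \<le> 0} \<and> 0 \<le> Im z"
      then have "Im z = 0" "cmod z = 1" by auto
      then have "\<bar>Re z\<bar> = 1" by (simp add: cmod_eq_Re)
      then have "Re z = 1 \<or> Re z = -1" by linarith
      then show "h (arccos (Re z)) = h (- arccos (Re z))" using h(2) by auto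
    qed
  qed
  moreover have "(?S \<inter> {z. 0 \<le> Im z}) \<union> (?S \<inter> {z. Im z \<le> 0}) = ?S" by auto
  ultimately have "continuous_on ?S H" by simp
  then obtain r where r: "real_polynomial_function r" "\<And>z. z \<in> ?S \<Longrightarrow> \<bar>H z - r z\<bar> < e"
    using Stone_Weierstrass_real_polynomial_function[OF compact_sphere _ \<open>e > 0\<close>] by metis
  have H: "H (cis t) = h t" if "t \<in> {-pi..pi}" for t
  proof -
    have "t = -pi \<or> (-pi < t \<and> t < 0) \<or> (0 \<le> t \<and> t \<le> pi)" using that by auto
    then consider "t = -pi" | "-pi < t" "t < 0" | "0 \<le> t" "t \<le> pi" by blast
    then show ?thesis
    proof cases
      case 1
      then show ?thesis by (simp add: H_def h(2))
    next
      case 2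
      then have "sin t < 0" using sin_gt_zero[of "-t"] by simp
      moreover have "arccos (cos t) = - t" using arccos_cos2[of t] 2 by simp
      ultimately show ?thesis by (simp add: H_def)
    next
      case 3
      then show ?thesis by (simp add: H_def sin_ge_zero arccos_cos)
    qed
  qed
  have "cmod (complex_of_real (h t) - complex_of_real (r (cis t))) < e" if "t \<in> {-pi..pi}" for t
    using r(2)[of "cis t"] H[OF that] by (simp flip: of_real_diff)
  then show ?thesis
    by (rule that[OF trig_poly_real_polynomial_function[OF r(1)]])
qed

section \<open>Density in the square integrable functions and Parseval's identity\<close>

lemma continuous_trig_poly: "trig_poly p \<Longrightarrow> continuous_on UNIV p"
  by (induction rule: trig_poly.induct) (auto intro!: continuous_intros)

text \<open>
  Stated with the nonnegative integral, so that no integrability has to be carried along.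
\<close>

definition L2_approximable :: "(real \<Rightarrow> real) \<Rightarrow> bool" where
  "L2_approximable g \<longleftrightarrow> (\<forall>e>0. \<exists>p. trig_poly p \<and>
     (\<integral>\<^sup>+t. ennreal ((cmod (complex_of_real (g t) - p t))\<^sup>2) \<partial>circle_measure) < ennreal e)"

text \<open>
  Dominated convergence makes \<open>u i\<close> close to \<open>g\<close> in mean square, and the triangle inequality
  transfers an approximation of \<open>u i\<close> to \<open>g\<close>. Each of the following steps enlarges the class of
  approximable functions by this lemma.
\<close>

lemma L2_approximable_dominated_limit:
  fixes u :: "nat \<Rightarrow> real \<Rightarrow> real"
  assumes meas: "g \<in> borel_measurable borel" "\<And>i. u i \<in> borel_measurable borel" "w \<in> borel_measurable borel"
    and lim: "AE t in circle_measure. (\<lambda>i. u i t) \<longlonglongrightarrow> g t"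
    and bound: "\<And>i t. \<bar>u i t - g t\<bar> \<le> w t"
    and w: "(\<integral>\<^sup>+t. ennreal ((w t)\<^sup>2) \<partial>circle_measure) < \<infinity>"
    and u: "\<And>i. L2_approximable (u i)"
  shows "L2_approximable g"
  unfolding L2_approximable_def
proof (intro allI impI)
  fix e :: real assume "e > 0"
  note [measurable] = meas[THEN borel_measurable_circle]
  have "(\<lambda>i. \<integral>\<^sup>+t. ennreal ((u i t - g t)\<^sup>2) \<partial>circle_measure) \<longlonglongrightarrow> (\<integral>\<^sup>+t. 0 \<partial>circle_measure)"
  proof (rule nn_integral_dominated_convergence[OF _ _ _ _ w])
    show "AE t in circle_measure. ennreal ((u i t - g t)\<^sup>2) \<le> ennreal ((w t)\<^sup>2)" for i
      using bound[of i] by (auto intro!: always_eventually ennreal_leI simp: abs_le_square_iff[symmetric] order_trans[OF _ abs_ge_self])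
    show "AE t in circle_measure. (\<lambda>i. ennreal ((u i t - g t)\<^sup>2)) \<longlonglongrightarrow> 0"
      using lim
    proof eventually_elim
      fix t assume "(\<lambda>i. u i t) \<longlonglongrightarrow> g t"
      then have "(\<lambda>i. (u i t - g t)\<^sup>2) \<longlonglongrightarrow> (g t - g t)\<^sup>2" by (intro tendsto_intros)
      then show "(\<lambda>i. ennreal ((u i t - g t)\<^sup>2)) \<longlonglongrightarrow> 0" 
        by (metis cancel_comm_monoid_add_class.diff_cancel ennreal_0 tendsto_ennrealI zero_power2)
    qed
  qed measurable
  then have "eventually (\<lambda>i. (\<integral>\<^sup>+t. ennreal ((u i t - g t)\<^sup>2) \<partial>circle_measure) < ennreal (e / 4)) sequentially"
    using \<open>e > 0\<close> by (intro order_tendstoD(2)) auto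
  then obtain i where i: "(\<integral>\<^sup>+t. ennreal ((u i t - g t)\<^sup>2) \<partial>circle_measure) < ennreal (e / 4)"
    by (auto simp: eventually_sequentially)
  obtain p where p: "trig_poly p" "(\<integral>\<^sup>+t. ennreal ((cmod (complex_of_real (u i t) - p t))\<^sup>2) \<partial>circle_measure) < ennreal (e / 4)"
    using u[of i] \<open>e > 0\<close> unfolding L2_approximable_def by (meson divide_pos_pos zero_less_numeral)
  have [measurable]: "p \<in> borel_measurable circle_measure"
    using continuous_trig_poly[OF p(1)] by (intro borel_measurable_circle borel_measurable_continuous_onI)
  have pt: "(cmod (complex_of_real (g t) - p t))\<^sup>2 \<le> 2 * (u i t - g t)\<^sup>2 + 2 * (cmod (complex_of_real (u i t) - p t))\<^sup>2" for t
  proof -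
    have "complex_of_real (g t) - p t = complex_of_real (g t - u i t) + (complex_of_real (u i t) - p t)" by simp
    then have "cmod (complex_of_real (g t) - p t) \<le> cmod (complex_of_real (g t - u i t)) + cmod (complex_of_real (u i t) - p t)"
      by (simp only: norm_triangle_ineq)
    then have "cmod (complex_of_real (g t) - p t) \<le> \<bar>u i t - g t\<bar> + cmod (complex_of_real (u i t) - p t)"
      by (simp only: norm_of_real abs_minus_commute)
    then have "(cmod (complex_of_real (g t) - p t))\<^sup>2 \<le> (\<bar>u i t - g t\<bar> + cmod (complex_of_real (u i t) - p t))\<^sup>2" by (intro power_mono) auto
    also have "\<dots> \<le> 2 * \<bar>u i t - g t\<bar>\<^sup>2 + 2 * (cmod (complex_of_real (u i t) - p t))\<^sup>2"
      using sum_squares_bound[of "\<bar>u i t - g t\<bar>" "cmod (complex_of_real (u i t) - p t)"] by (simp only: power2_sum)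
    finally show ?thesis by simp
  qed
  have "(\<integral>\<^sup>+t. ennreal ((cmod (complex_of_real (g t) - p t))\<^sup>2) \<partial>circle_measure)
     \<le> (\<integral>\<^sup>+t. 2 * ennreal ((u i t - g t)\<^sup>2) + 2 * ennreal ((cmod (complex_of_real (u i t) - p t))\<^sup>2) \<partial>circle_measure)"
  proof (rule nn_integral_mono)
    fix t show "ennreal ((cmod (complex_of_real (g t) - p t))\<^sup>2) \<le> 2 * ennreal ((u i t - g t)\<^sup>2) + 2 * ennreal ((cmod (complex_of_real (u i t) - p t))\<^sup>2)"
      using ennreal_leI[OF pt[of t]] by (simp add: ennreal_mult ennreal_plus)
  qed
  also have "\<dots> = 2 * (\<integral>\<^sup>+t. ennreal ((u i t - g t)\<^sup>2) \<partial>circle_measure) +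
      2 * (\<integral>\<^sup>+t. ennreal ((cmod (complex_of_real (u i t) - p t))\<^sup>2) \<partial>circle_measure)"
    by (simp add: nn_integral_add nn_integral_cmult)
  also have "\<dots> < 2 * ennreal (e / 4) + 2 * ennreal (e / 4)"
    using i p(2) by (intro add_strict_mono ennreal_mult_strict_left_mono) auto
  also have "\<dots> = ennreal e"
  proof -
    have "2 * ennreal (e / 4) = ennreal (2 * (e / 4))"
      using \<open>e > 0\<close> by (subst ennreal_mult) auto
    then have "2 * ennreal (e / 4) + 2 * ennreal (e / 4) = ennreal (2 * (e / 4) + 2 * (e / 4))"
      using \<open>e > 0\<close> by (subst ennreal_plus) auto
    moreover have "2 * (e / 4) + 2 * (e / 4) = e" by simp
    ultimately show ?thesis by metis
  qed
  finally show "\<exists>p. trig_poly p \<and> (\<integral>\<^sup>+t. ennreal ((cmod (complex_of_real (g t) - p t))\<^sup>2) \<partial>circle_measure) < ennreal e"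
    using p(1) by blast
qed

lemma emeasure_circle: "emeasure circle_measure {-pi..pi} = ennreal (2 * pi)"
  by (simp add: emeasure_restrict_space)

lemma nn_integral_circle_const_finite: "(\<integral>\<^sup>+t. ennreal c \<partial>circle_measure) < \<infinity>"
  by (simp add: emeasure_circle ennreal_mult_less_top)

lemma AE_circle_not_pi: "AE t in circle_measure. t \<in> {-pi<..<pi}"
proof -
  have "AE t in lborel. t \<noteq> c" for c :: real
    using AE_lborel_singleton[of c] by simp
  then have "AE t in lebesgue. t \<noteq> c" for c :: real
    by (rule AE_completion)
  then have "AE t in lebesgue. t \<noteq> pi \<and> t \<noteq> -pi" by (simp add: AE_conj_iff)
  then have "AE t in lebesgue. t \<in> {-pi..pi} \<longrightarrow> t \<in> {-pi<..<pi}" by eventually_elim auto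
  then show ?thesis by (subst AE_restrict_space_iff) simp_all
qed

lemma L2_approximable_continuous_periodic:
  fixes h :: "real \<Rightarrow> real"
  assumes h: "continuous_on {-pi..pi} h" "h (- pi) = h pi"
  shows "L2_approximable h"
  unfolding L2_approximable_def
proof (intro allI impI)
  fix e :: real assume "e > 0"
  then have "sqrt (e / (4 * pi)) > 0" by simp
  then obtain p where p: "trig_poly p" "\<And>t. t \<in> {-pi..pi} \<Longrightarrow> cmod (complex_of_real (h t) - p t) < sqrt (e / (4 * pi))"
    using continuous_periodic_trig_poly_approx[OF h] by metis
  have "(\<integral>\<^sup>+t. ennreal ((cmod (complex_of_real (h t) - p t))\<^sup>2) \<partial>circle_measure) \<le> (\<integral>\<^sup>+t. ennreal (e / (4 * pi)) \<partial>circle_measure)"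
  proof (rule nn_integral_mono)
    fix t assume "t \<in> space circle_measure"
    then have "(cmod (complex_of_real (h t) - p t))\<^sup>2 \<le> (sqrt (e / (4 * pi)))\<^sup>2"
      using p(2)[of t] by (intro power_mono) auto
    then show "ennreal ((cmod (complex_of_real (h t) - p t))\<^sup>2) \<le> ennreal (e / (4 * pi))"
      using \<open>e > 0\<close> by (intro ennreal_leI) simp
  qed
  also have "\<dots> = ennreal (e / 2)"
    using \<open>e > 0\<close> by (simp add: emeasure_circle ennreal_mult[symmetric])
  also have "\<dots> < ennreal e" using \<open>e > 0\<close> by (simp add: ennreal_less_iff)
  finally show "\<exists>p. trig_poly p \<and> (\<integral>\<^sup>+t. ennreal ((cmod (complex_of_real (h t) - p t))\<^sup>2) \<partial>circle_measure) < ennreal e"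
    using p(1) by blast
qed

text \<open>
  Multiplication by a piecewise linear cutoff that vanishes at \<open>pi\<close> and \<open>- pi\<close> makes the boundary
  values agree; the cutoffs tend to \<open>1\<close> off these two points.
\<close>

lemma L2_approximable_continuous:
  fixes h :: "real \<Rightarrow> real"
  assumes h: "continuous_on UNIV h" and M: "\<And>t. \<bar>h t\<bar> \<le> M"
  shows "L2_approximable h"
proof (rule L2_approximable_dominated_limit)
  let ?c = "\<lambda>j t. max 0 (min 1 (real j * (pi - \<bar>t\<bar>)))"
  have c: "0 \<le> ?c j t" "?c j t \<le> 1" for j t by auto
  have cont: "continuous_on UNIV (\<lambda>t. ?c j t * h t)" for j
    by (intro continuous_intros h)
  show "L2_approximable (\<lambda>t. ?c j t * h t)" for j
    by (rule L2_approximable_continuous_periodic[OF continuous_on_subset[OF cont]]) auto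
  show "h \<in> borel_measurable borel" "(\<lambda>t. ?c j t * h t) \<in> borel_measurable borel" for j
    using h cont by (auto intro: borel_measurable_continuous_onI)
  show "AE t in circle_measure. (\<lambda>j. ?c j t * h t) \<longlonglongrightarrow> h t"
    using AE_circle_not_pi
  proof eventually_elim
    case (elim t)
    then have "pi - \<bar>t\<bar> > 0" by auto
    then obtain N where N: "1 < real N * (pi - \<bar>t\<bar>)" using reals_Archimedean3[of "pi - \<bar>t\<bar>"] by metis
    \<comment> \<open>At an interior point the cutoff is eventually equal to \<open>1\<close>.\<close>
    have "?c j t = 1" if "j \<ge> N" for j
    proof -
      have "real N * (pi - \<bar>t\<bar>) \<le> real j * (pi - \<bar>t\<bar>)" using that \<open>pi - \<bar>t\<bar> > 0\<close> by simp
      then show ?thesis using N by simp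
    qed
    then have "eventually (\<lambda>j. ?c j t * h t = h t) sequentially"
      by (intro eventually_sequentiallyI[of N]) simp
    then show ?case by (rule tendsto_eventually)
  qed
  show "\<bar>?c j t * h t - h t\<bar> \<le> M" for j t
  proof -
    have "\<bar>?c j t * h t - h t\<bar> = \<bar>?c j t - 1\<bar> * \<bar>h t\<bar>" by (simp only: abs_mult[symmetric] left_diff_distrib mult_1_left)
    also have "\<dots> \<le> 1 * \<bar>h t\<bar>" using c[of j t] by (intro mult_right_mono) auto
    finally show ?thesis using M[of t] by simp
  qed
qed (simp_all only: nn_integral_circle_const_finite borel_measurable_const)

text \<open>
  A measurable function is an almost everywhere limit of continuous functions; truncating those at
  the bound of \<open>g\<close> provides the dominating constant.
\<close>

lemma L2_approximable_bounded:
  fixes g :: "real \<Rightarrow> real"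
  assumes g: "g \<in> borel_measurable borel" and M: "\<And>t. \<bar>g t\<bar> \<le> M"
  shows "L2_approximable g"
proof -
  have "g measurable_on UNIV"
    using g by (intro lebesgue_measurable_imp_measurable_on_real measurable_completion) auto
  then obtain N u where N: "negligible N" and u: "\<And>n. continuous_on UNIV (u n)"
      and lim: "\<And>x. x \<notin> N \<Longrightarrow> (\<lambda>n. u n x) \<longlonglongrightarrow> g x"
    unfolding measurable_on_def by auto
  let ?u = "\<lambda>n t. max (-M) (min M (u n t))"
  have M0: "0 \<le> M" using M[of 0] by simp
  have b: "\<bar>?u n t\<bar> \<le> M" for n t using M0 by auto
  have cont: "continuous_on UNIV (?u n)" for n by (intro continuous_intros u)
  show ?thesis
  proof (rule L2_approximable_dominated_limit)
    show "L2_approximable (?u n)" for n by (rule L2_approximable_continuous[OF cont b])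
    show "?u n \<in> borel_measurable borel" for n using cont by (rule borel_measurable_continuous_onI)
    show "\<bar>?u n t - g t\<bar> \<le> 2 * M" for n t using b[of n t] M[of t] by linarith
    have "AE t in lebesgue. t \<notin> N" using N by (simp add: negligible_iff_null_sets AE_not_in)
    then have "AE t in circle_measure. t \<notin> N" by (auto simp: AE_restrict_space_iff)
    then show "AE t in circle_measure. (\<lambda>n. ?u n t) \<longlonglongrightarrow> g t"
    proof eventually_elim
      case (elim t)
      have "(\<lambda>n. ?u n t) \<longlonglongrightarrow> max (-M) (min M (g t))" by (intro tendsto_intros lim elim)
      moreover have "max (-M) (min M (g t)) = g t" using M[of t] by auto
      ultimately show ?case by simp
    qed
  qed (use g in \<open>simp_all only: nn_integral_circle_const_finite borel_measurable_const\<close>)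
qed

lemma L2_approximable_square_integrable:
  fixes g :: "real \<Rightarrow> real"
  assumes g: "g \<in> borel_measurable borel" "(\<integral>\<^sup>+t. ennreal ((g t)\<^sup>2) \<partial>circle_measure) < \<infinity>"
  shows "L2_approximable g"
proof (rule L2_approximable_dominated_limit)
  let ?u = "\<lambda>n t. max (- real n) (min (real n) (g t))"
  show m: "?u n \<in> borel_measurable borel" for n using g(1) by measurable
  show "L2_approximable (?u n)" for n by (rule L2_approximable_bounded[OF m, where M = "real n"]) auto
  show "\<bar>?u n t - g t\<bar> \<le> \<bar>g t\<bar>" for n t by auto
  show "(\<lambda>t. \<bar>g t\<bar>) \<in> borel_measurable borel" using g(1) by measurable
  have "(\<lambda>n. ?u n t) \<longlonglongrightarrow> g t" for t
  proof (rule tendsto_eventually, rule eventually_sequentiallyI)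
    fix n assume "nat \<lceil>\<bar>g t\<bar>\<rceil> \<le> n"
    then have "\<bar>g t\<bar> \<le> real n" by linarith
    then show "?u n t = g t" by auto
  qed
  then show "AE t in circle_measure. (\<lambda>n. ?u n t) \<longlonglongrightarrow> g t" by simp
qed (use g in auto)

lemma sum_symmetric_int:
  fixes f :: "int \<Rightarrow> 'a::comm_monoid_add"
  assumes "\<And>k. f (- k) = f k"
  shows "(\<Sum>k\<in>{-int N..int N}. f k) = f 0 + (\<Sum>n\<in>{1..N}. f (int n) + f (int n))"
proof (induction N)
  case (Suc N)
  have "{-int (Suc N)..int (Suc N)} = insert (int (Suc N)) (insert (- int (Suc N)) {-int N..int N})" by auto
  then show ?case using Suc assms[of "int (Suc N)"] by (simp add: add_ac del: of_nat_Suc)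
qed simp

text \<open>
  For real \<open>g\<close> the coefficients at \<open>n\<close> and \<open>- n\<close> are conjugate, which produces the weight \<open>2\<close> for
  positive \<open>n\<close>.
\<close>

theorem Parseval_real:
  fixes g :: "real \<Rightarrow> real"
  assumes g: "g \<in> borel_measurable borel" "integrable circle_measure (\<lambda>t. (g t)\<^sup>2)"
  defines "c \<equiv> \<lambda>n. (LINT t|circle_measure. complex_of_real (g t) * cis (real n * t))"
  shows "(\<lambda>n. (if n = 0 then 1 else 2) * (cmod (c n))\<^sup>2) sums (2 * pi * (LINT t|circle_measure. (g t)\<^sup>2))"
proof -
  have gm: "g \<in> borel_measurable circle_measure" using g(1) by (rule borel_measurable_circle)
  have fin: "(\<integral>\<^sup>+t. ennreal ((g t)\<^sup>2) \<partial>circle_measure) < \<infinity>"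
    using g(2) by (simp add: integrable_iff_bounded)
  define \<gamma> where "\<gamma> = (\<lambda>k::int. (LINT t|circle_measure. complex_of_real (g t) * cis (- of_int k * t)))"
  have cnj\<gamma>: "\<gamma> (- k) = cnj (\<gamma> k)" for k
  proof -
    have e: "complex_of_real (g t) * cis (- of_int (-k) * t) = cnj (complex_of_real (g t) * cis (- of_int k * t))" for t
      by (simp add: cis_cnj)
    show ?thesis unfolding \<gamma>_def e by (rule Bochner_Integration.integral_cnj)
  qed
  have c\<gamma>: "c n = \<gamma> (- int n)" for n by (simp add: c_def \<gamma>_def)
  have cm: "cmod (\<gamma> (- k)) = cmod (\<gamma> k)" for k by (simp add: cnj\<gamma>)
  define S where "S = (\<lambda>N. \<Sum>k\<in>{-int N..int N}. (cmod (\<gamma> k))\<^sup>2)"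
  have S: "S N = (\<Sum>n<Suc N. (if n = 0 then 1 else 2) * (cmod (c n))\<^sup>2)" for N
  proof -
    have "S N = (cmod (\<gamma> 0))\<^sup>2 + (\<Sum>n\<in>{1..N}. 2 * (cmod (c n))\<^sup>2)"
      unfolding S_def by (subst sum_symmetric_int) (simp_all add: cm c\<gamma>)
    also have "\<dots> = (\<Sum>n<Suc N. (if n = 0 then 1 else 2) * (cmod (c n))\<^sup>2)"
      unfolding sum.lessThan_Suc_shift by (simp add: c\<gamma> sum.atLeast1_atMost_eq)
    finally show ?thesis .
  qed
  let ?I = "LINT t|circle_measure. (g t)\<^sup>2"
  \<comment> \<open>The partial sums never exceed the integral; a trigonometric polynomial of degree \<open>N0\<close>
     with mean square error below \<open>e\<close> shows that from \<open>N0\<close> on they fall short of it by less than \<open>e\<close>.\<close>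
  have bessel: "S N / (2 * pi) \<le> ?I" for N
  proof -
    let ?K = "{-int N..int N}" let ?a = "\<lambda>k. \<gamma> k / (2 * pi)"
    have "0 \<le> (LINT t|circle_measure. (cmod (g t - (\<Sum>k\<in>?K. ?a k * cis (of_int k * t))))\<^sup>2)" by simp
    also have "\<dots> = ?I - S N / (2 * pi)"
      using square_distance_trig_poly[OF gm g(2), of ?K ?a] by (simp add: \<gamma>_def S_def)
    finally show ?thesis by simp
  qed
  have "(\<lambda>N. S N / (2 * pi)) \<longlonglongrightarrow> ?I"
  proof (rule LIMSEQ_I)
    fix e :: real assume "e > 0"
    then obtain p where p: "trig_poly p" "(\<integral>\<^sup>+t. ennreal ((cmod (complex_of_real (g t) - p t))\<^sup>2) \<partial>circle_measure) < ennreal e"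
      using L2_approximable_square_integrable[OF g(1) fin] unfolding L2_approximable_def by blast
    obtain a N0 where a: "\<And>N t. N \<ge> N0 \<Longrightarrow> p t = (\<Sum>k\<in>{-int N..int N}. a k * cis (of_int k * t))"
      using trig_poly_finite_sum[OF p(1)] by metis
    have pm: "p \<in> borel_measurable circle_measure"
      using continuous_trig_poly[OF p(1)] by (intro borel_measurable_circle borel_measurable_continuous_onI)
    have "\<bar>S N / (2 * pi) - ?I\<bar> < e" if "N \<ge> N0" for N
    proof -
      have "?I - S N / (2 * pi) \<le> (LINT t|circle_measure. (cmod (complex_of_real (g t) - p t))\<^sup>2)"
        unfolding a[OF that] by (subst square_distance_trig_poly[OF gm g(2)])
          (auto simp: \<gamma>_def S_def intro!: mult_nonneg_nonneg sum_nonneg)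
      also have "\<dots> = enn2real (\<integral>\<^sup>+t. ennreal ((cmod (complex_of_real (g t) - p t))\<^sup>2) \<partial>circle_measure)"
        using gm pm by (intro integral_eq_nn_integral) auto
      also have "\<dots> < e" using p(2) \<open>e > 0\<close> by (subst enn2real_less_iff) (auto simp: less_top[symmetric])
      finally show ?thesis using bessel[of N] by simp
    qed
    then show "\<exists>no. \<forall>n\<ge>no. norm (S n / (2 * pi) - ?I) < e" by auto
  qed
  then have "(\<lambda>N. S N / (2 * pi) * (2 * pi)) \<longlonglongrightarrow> ?I * (2 * pi)" by (intro tendsto_intros)
  then have "S \<longlonglongrightarrow> 2 * pi * ?I" by (simp add: mult_ac)
  then have "(\<lambda>N. \<Sum>n<Suc N. (if n = 0 then 1 else 2) * (cmod (c n))\<^sup>2) \<longlonglongrightarrow> 2 * pi * ?I"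
    unfolding S[abs_def] .
  then show ?thesis unfolding sums_def by (subst filterlim_sequentially_Suc[symmetric])
qed

section \<open>Logarithmic growth of the multiplier\<close>

definition log_kernel :: "real \<Rightarrow> real \<Rightarrow> real" where
  "log_kernel s t = log 2 (pi / \<bar>sin (t / 2)\<bar>) powr (2 * s - 1) / \<bar>sin (t / 2)\<bar>"

text \<open>
  The weight of \<open>|c\<^sub>n|\<^sup>2\<close> in the double integral, up to the factor \<open>4 / pi\<close>.
\<close>

definition multiplier :: "real \<Rightarrow> nat \<Rightarrow> ennreal" where
  "multiplier s n = (\<integral>\<^sup>+t. ennreal (log_kernel s t * (sin (real n * t / 2))\<^sup>2) \<partial>circle_measure)"

lemma log_kernel_nonneg: "0 \<le> log_kernel s t"
  by (simp add: log_kernel_def)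

lemma borel_measurable_log_kernel [measurable]: "log_kernel s \<in> borel_measurable borel"
  unfolding log_kernel_def[abs_def] by measurable

lemma nn_integral_circle:
  fixes F :: "real \<Rightarrow> ennreal"
  assumes "F \<in> borel_measurable borel"
  shows "(\<integral>\<^sup>+t. F t \<partial>circle_measure) = (\<integral>\<^sup>+t. F t * indicator {-pi..pi} t \<partial>lborel)"
  by (subst nn_integral_restrict_space) (simp_all add: nn_integral_completion)

text \<open>
  A bound from below by half the argument is enough to trap the logarithm of the kernel between
  \<open>\<ell>\<close> and \<open>\<ell> + 1\<close>. Taylor's bound is applied at \<open>x / 2 \<le> pi / 4\<close>, followed by the duplication
  formula.
\<close>

lemma half_le_sin:
  fixes x :: real
  assumes "0 \<le> x" "x \<le> pi / 2"
  shows "x / 2 \<le> sin x"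
proof -
  let ?y = "x / 2"
  have y: "0 \<le> ?y" "?y \<le> pi / 4" "?y \<le> 1" using assms pi_less_4 by auto
  have "\<bar>sin ?y - (\<Sum>m<3. sin_coeff m * ?y ^ m)\<bar> \<le> inverse (fact 3) * \<bar>?y\<bar> ^ 3"
    by (rule Maclaurin_sin_bound)
  then have "\<bar>sin ?y - ?y\<bar> \<le> ?y ^ 3 / 6"
    using y by (simp add: eval_nat_numeral sin_coeff_def field_simps)
  moreover have "?y ^ 3 \<le> ?y"
    using y power_decreasing[of 1 3 ?y] by simp
  ultimately have s: "5 / 6 * ?y \<le> sin ?y" by linarith
  have "cos (pi / 4) \<le> cos ?y" using y by (intro cos_monotone_0_pi_le) auto
  then have "sqrt 2 / 2 \<le> cos ?y" by (simp add: cos_45)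
  moreover have "7 / 5 \<le> sqrt (2::real)" by (rule real_le_rsqrt) (simp add: power2_eq_square)
  ultimately have c: "7 / 10 \<le> cos ?y" by linarith
  have "x / 2 \<le> 2 * (5 / 6 * ?y) * (7 / 10)" using assms by simp
  also have "\<dots> \<le> 2 * sin ?y * cos ?y" using s c y by (intro mult_mono) auto
  also have "\<dots> = sin x" using sin_double[of ?y] by simp
  finally show ?thesis .
qed

text \<open>
  The exponent \<open>2 * s - 1\<close> of the kernel may have either sign, so both comparisons of \<open>x\<close> with \<open>y\<close>
  are needed.
\<close>

lemma powr_le_of_comparable:
  fixes a x y :: real
  assumes "0 < x" "x \<le> 2 * y" "y \<le> 2 * x"
  shows "y powr a \<le> 2 powr \<bar>a\<bar> * x powr a"
proof (cases "a \<ge> 0")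
  case True
  then have "y powr a \<le> (2 * x) powr a" using assms by (intro powr_mono2) auto
  then show ?thesis using True assms by (simp add: powr_mult)
next
  case False
  then have "(2 * y) powr a \<le> x powr a" using assms by (intro powr_mono2') auto
  then have "2 powr (-a) * ((2 * y) powr a) \<le> 2 powr (-a) * x powr a" by (intro mult_left_mono) auto
  then show ?thesis using False assms by (simp add: powr_mult powr_minus field_simps)
qed

lemma ennreal_le_of_double_le:
  assumes "ennreal (2 * x) \<le> J + J"
  shows "ennreal x \<le> J"
  using assms by (cases J) (auto simp: ennreal_le_iff2 simp flip: ennreal_plus)

context
  fixes s :: real
  assumes s: "0 < s"
begin

text \<open>
  The model kernel \<open>psi\<close> replaces \<open>sin (t / 2)\<close> by a multiple of \<open>t\<close>. The factor \<open>2 * pi\<close> keeps \<open>ell\<close>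
  at least \<open>1\<close> on the whole interval \<open>(0, pi]\<close>.
\<close>

abbreviation (input) "ell t \<equiv> log 2 (2 * pi / t)"
abbreviation (input) "psi t \<equiv> ell t powr (2 * s - 1) / t"

lemma one_le_ell: "0 < t \<Longrightarrow> t \<le> pi \<Longrightarrow> 1 \<le> ell t"
  by (subst le_log_iff) (simp_all add: field_simps)

lemma two_le_ell: "0 < t \<Longrightarrow> t \<le> pi / 2 \<Longrightarrow> 2 \<le> ell t"
  by (subst le_log_iff) (simp_all add: field_simps)

lemma log_kernel_comparable_psi:
  assumes "0 < t" "t \<le> pi"
  shows "2 / 2 powr \<bar>2 * s - 1\<bar> * psi t \<le> log_kernel s t"
    and "log_kernel s t \<le> 4 * 2 powr \<bar>2 * s - 1\<bar> * psi t"
proof -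
  define S where "S = sin (t / 2)"
  have S: "t / 4 \<le> S" "S \<le> t / 2" "0 < S"
    using half_le_sin[of "t / 2"] sin_x_le_x[of "t / 2"] assms by (auto simp: S_def)
  define m where "m = log 2 (pi / S)"
  have l: "1 \<le> ell t" by (rule one_le_ell) fact+
  have "ell t \<le> m" unfolding m_def using S assms by (subst log_le_cancel_iff) (auto simp: field_simps)
  moreover have "m \<le> ell t + 1"
  proof -
    have "m \<le> log 2 (2 * pi / t * 2)" unfolding m_def using S assms by (subst log_le_cancel_iff) (auto simp: field_simps)
    also have "\<dots> = ell t + 1" using assms by (subst log_mult) auto
    finally show ?thesis .
  qed
  ultimately have m: "0 < m" "m \<le> 2 * ell t" "ell t \<le> 2 * m" using l by auto
  have k: "log_kernel s t = m powr (2 * s - 1) / S" using S by (simp add: log_kernel_def m_def S_def)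
  have p1: "m powr (2 * s - 1) \<le> 2 powr \<bar>2 * s - 1\<bar> * ell t powr (2 * s - 1)"
    using m l by (intro powr_le_of_comparable) auto
  have p2: "ell t powr (2 * s - 1) \<le> 2 powr \<bar>2 * s - 1\<bar> * m powr (2 * s - 1)"
    using m l by (intro powr_le_of_comparable) auto
  have "m powr (2 * s - 1) / S \<le> (2 powr \<bar>2 * s - 1\<bar> * ell t powr (2 * s - 1)) / (t / 4)"
    using p1 S assms by (intro frac_le) auto
  then show "log_kernel s t \<le> 4 * 2 powr \<bar>2 * s - 1\<bar> * psi t" by (simp add: k mult_ac)
  have "(ell t powr (2 * s - 1) / 2 powr \<bar>2 * s - 1\<bar>) / (t / 2) \<le> m powr (2 * s - 1) / S"
    using p2 S assms by (intro frac_le) (auto simp: field_simps)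
  then show "2 / 2 powr \<bar>2 * s - 1\<bar> * psi t \<le> log_kernel s t" by (simp add: k mult_ac)
qed

text \<open>
  The derivative of \<open>\<ell>(t) powr (2 * s)\<close> is \<open>- (2 * s / ln 2) * \<psi>(t)\<close>.
\<close>

lemma nn_integral_psi:
  assumes "0 < A" "A \<le> B" "B \<le> pi"
  shows "(\<integral>\<^sup>+t. ennreal (psi t) * indicator {A..B} t \<partial>lborel)
    = ennreal (ln 2 / (2 * s) * (ell A powr (2 * s) - ell B powr (2 * s)))"
proof -
  let ?F = "\<lambda>t. - (ln 2 / (2 * s)) * ell t powr (2 * s)"
  have "(\<integral>\<^sup>+t. ennreal (psi t) * indicator {A..B} t \<partial>lborel) = ennreal (?F B - ?F A)"
  proof (rule nn_integral_FTC_Icc)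
    fix t assume t: "t \<in> {A..B}"
    then have t0: "0 < t" "t \<le> pi" using assms by auto
    have l: "1 \<le> ell t" using one_le_ell t0 by blast
    have d: "((\<lambda>t. ell t) has_real_derivative (- 1 / (t * ln 2))) (at t)"
      using t0 by (auto intro!: derivative_eq_intros simp: field_simps power2_eq_square)
    have "((\<lambda>t. ell t powr (2 * s)) has_real_derivative
        (2 * s * ell t powr (2 * s - 1) * (- 1 / (t * ln 2)))) (at t)"
      using DERIV_fun_powr[OF d, of "2 * s"] l by simp
    from DERIV_cmult[OF this, of "- (ln 2 / (2 * s))"]
    show "(?F has_real_derivative psi t) (at t)" using s t0 by (simp add: field_simps)
    show "0 \<le> psi t" using t0 by simp
  qed (use assms in auto)
  then show ?thesis by (simp add: algebra_simps)
qed

text \<open>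
  The integral is split at \<open>t = 1 / n\<close>. Beyond this point \<open>sin\<^sup>2 \<le> 1\<close> and the antiderivative of
  \<open>\<psi>\<close> is available. Below it \<open>\<ell>(t)\<close> is at most \<open>log 2 (2 * pi * n)\<close> times
  \<open>1 + log 2 (1 / (n t))\<close>, and the latter factor is beaten by one of the two powers
  of \<open>n t\<close> gained from the sine, so that on an interval of length \<open>1 / n\<close> the integrand is at most
  a multiple of \<open>n * log 2 (2 * pi * n) powr (2 * s)\<close>.
\<close>

lemma multiplier_upper:
  "\<exists>K>0. \<forall>n\<ge>1. multiplier s n \<le> ennreal (K * log 2 (real n + 1) powr (2 * s))"
proof -
  define C1 where "C1 = 4 * 2 powr \<bar>2 * s - 1\<bar>"
  define C2 where "C2 = (1 + 2 * s / ln 2) powr (2 * s)"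
  define D where "D = C2 + ln 2 / (2 * s)"
  have "0 < 1 + 2 * s / ln 2" using s by (intro add_pos_nonneg) auto
  then have pos: "0 < C1" "0 < C2" by (auto simp: C1_def C2_def)
  then have "0 < D" using s by (simp add: D_def add_pos_pos)
  note pos = pos this
  \<comment> \<open>The logarithm is below a multiple of the power \<open>1 / (2 * s)\<close>, hence its power \<open>2 * s\<close> below a
     multiple of \<open>z\<close>.\<close>
  have log_bound: "(1 + log 2 z) powr (2 * s) \<le> C2 * z" if "1 \<le> z" for z
  proof -
    have "ln z \<le> z powr (1 / (2 * s)) / (1 / (2 * s))" using s that by (intro ln_powr_bound) auto
    then have "log 2 z \<le> 2 * s / ln 2 * z powr (1 / (2 * s))" by (simp add: log_def field_simps)
    moreover have "1 \<le> z powr (1 / (2 * s))" using s that by (intro ge_one_powr_ge_zero) auto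
    ultimately have "1 + log 2 z \<le> (1 + 2 * s / ln 2) * z powr (1 / (2 * s))"
      by (simp add: distrib_right)
    then have "(1 + log 2 z) powr (2 * s) \<le> ((1 + 2 * s / ln 2) * z powr (1 / (2 * s))) powr (2 * s)"
      using s that by (intro powr_mono2) auto
    also have "\<dots> = C2 * z" using s that by (simp add: powr_mult powr_powr C2_def)
    finally show ?thesis .
  qed
  have main: "multiplier s n \<le> ennreal (2 * C1 * D * 4 powr (2 * s) * log 2 (real n + 1) powr (2 * s))" if n: "n \<ge> 1" for n
  proof -
    have n0: "real n \<ge> 1" using n by simp
    define B where "B = log 2 (2 * pi * n)"
    have B1: "1 \<le> B" unfolding B_def using n0 pi_ge_two mult_mono[of 1 pi 1 "real n"] by (subst le_log_iff) auto
    have B: "B \<le> 4 * log 2 (real n + 1)"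
    proof -
      have "pi * real n \<le> 4 * real n" using pi_less_4 by (intro mult_right_mono) auto
      then have "2 * pi * n \<le> 8 * (real n + 1)" by (simp add: mult.assoc)
      then have "B \<le> log 2 (8 * (real n + 1))" unfolding B_def using n0 by (intro log_mono) auto
      also have "\<dots> = 3 + log 2 (real n + 1)" using n0 log_nat_power[of 2 2 3] by (subst log_mult) auto
      also have "1 \<le> log 2 (real n + 1)" using n0 by (subst le_log_iff) auto
      then have "3 + log 2 (real n + 1) \<le> 4 * log 2 (real n + 1)" by simp
      finally show ?thesis .
    qed
    define H where "H = (\<lambda>t. ennreal (C1 * C2 * n * B powr (2 * s)) * indicator {0..1 / real n} t
        + ennreal C1 * (ennreal (psi t) * indicator {1 / real n..pi} t))"
    have "1 / real n \<le> 1" using n0 by simp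
    then have le_pi: "1 / real n \<le> pi" using pi_ge_two by linarith
    have near: "log_kernel s t * (sin (real n * t / 2))\<^sup>2 \<le> C1 * C2 * n * B powr (2 * s)"
      if t: "0 < t" "t \<le> 1 / n" for t
    proof -
      have tpi: "t \<le> pi" using t le_pi by linarith
      have nt: "0 < n * t" "n * t \<le> 1" using t n0 by (auto simp: field_simps)
      have l: "1 \<le> ell t" using one_le_ell t tpi by blast
      have "ell t = log 2 (2 * pi * n * (1 / (n * t)))" using n0 t by simp
      also have "\<dots> = B + log 2 (1 / (n * t))" unfolding B_def using n0 t nt by (subst log_mult) auto
      also have "\<dots> \<le> B * (1 + log 2 (1 / (n * t)))"
      proof -
        have "0 \<le> log 2 (1 / (n * t))" using nt by (subst zero_le_log_cancel_iff) (auto simp: field_simps)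
        then have "1 * log 2 (1 / (n * t)) \<le> B * log 2 (1 / (n * t))" using B1 by (intro mult_right_mono)
        then show ?thesis by (simp add: distrib_left)
      qed
      finally have "ell t powr (2 * s) \<le> (B * (1 + log 2 (1 / (n * t)))) powr (2 * s)"
        using s l by (intro powr_mono2) auto
      also have "\<dots> = B powr (2 * s) * (1 + log 2 (1 / (n * t))) powr (2 * s)"
        using B1 nt by (subst powr_mult) (auto intro!: add_nonneg_nonneg simp: zero_le_log_cancel_iff field_simps)
      also have "\<dots> \<le> B powr (2 * s) * (C2 * (1 / (n * t)))"
        using nt by (intro mult_left_mono log_bound) (auto simp: field_simps)
      finally have e: "ell t powr (2 * s) \<le> B powr (2 * s) * C2 / (n * t)" by simp
      have "\<bar>sin (real n * t / 2)\<bar> \<le> n * t" using abs_sin_x_le_abs_x[of "real n * t / 2"] nt by simp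
      then have "(sin (real n * t / 2))\<^sup>2 \<le> (n * t)\<^sup>2" using power_mono[of "\<bar>sin (real n * t / 2)\<bar>" "n * t" 2] by simp
      moreover have "log_kernel s t \<le> C1 * (B powr (2 * s) * C2 / (n * t)) / t"
      proof -
        have "log_kernel s t \<le> C1 * psi t" unfolding C1_def by (rule log_kernel_comparable_psi) fact+
        also have "\<dots> \<le> C1 * (ell t powr (2 * s) / t)"
          using l t pos by (intro mult_left_mono divide_right_mono powr_mono) auto
        also have "\<dots> \<le> C1 * ((B powr (2 * s) * C2 / (n * t)) / t)"
          using e t pos by (intro mult_left_mono divide_right_mono) auto
        finally show ?thesis by simp
      qed
      ultimately have "log_kernel s t * (sin (real n * t / 2))\<^sup>2
          \<le> (C1 * (B powr (2 * s) * C2 / (n * t)) / t) * (n * t)\<^sup>2"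
        using log_kernel_nonneg pos t nt by (intro mult_mono) auto
      also have "\<dots> = C1 * C2 * n * B powr (2 * s)" using t nt n0 by (simp add: power2_eq_square field_simps)
      finally show ?thesis .
    qed
    have far: "log_kernel s t * (sin (real n * t / 2))\<^sup>2 \<le> C1 * psi t" if t: "0 < t" "t \<le> pi" for t
    proof -
      have "log_kernel s t * (sin (real n * t / 2))\<^sup>2 \<le> log_kernel s t * 1"
        using log_kernel_nonneg by (intro mult_left_mono) (auto simp: abs_square_le_1)
      also have "\<dots> \<le> C1 * psi t" unfolding C1_def using log_kernel_comparable_psi(2)[OF t] by simp
      finally show ?thesis .
    qed
    have pointwise: "ennreal (log_kernel s t * (sin (real n * t / 2))\<^sup>2) \<le> H t" if t: "0 \<le> t" "t \<le> pi" for t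
    proof -
      consider "t = 0" | "0 < t" "t \<le> 1 / n" | "1 / n \<le> t" "0 < t" using t by linarith
      then show ?thesis
      proof cases
        case 1 then show ?thesis by simp
      next
        case 2
        then have "ennreal (log_kernel s t * (sin (real n * t / 2))\<^sup>2) \<le> ennreal (C1 * C2 * n * B powr (2 * s))"
          by (intro ennreal_leI near)
        also have "\<dots> \<le> H t" unfolding H_def using 2 by (simp add: add_increasing2)
        finally show ?thesis .
      next
        case 3
        then have "ennreal (log_kernel s t * (sin (real n * t / 2))\<^sup>2) \<le> ennreal (C1 * psi t)"
          using t by (intro ennreal_leI far) auto
        also have "\<dots> = ennreal C1 * ennreal (psi t)" using pos 3 by (subst ennreal_mult) auto
        also have "\<dots> \<le> H t" unfolding H_def using 3 t by (simp add: add_increasing)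
        finally show ?thesis .
      qed
    qed
    have even: "log_kernel s (- t) * (sin (real n * (- t) / 2))\<^sup>2 = log_kernel s t * (sin (real n * t / 2))\<^sup>2" for t
      by (simp add: log_kernel_def)
    have Hm [measurable]: "H \<in> borel_measurable borel" unfolding H_def by measurable
    have "multiplier s n = (\<integral>\<^sup>+t. ennreal (log_kernel s t * (sin (real n * t / 2))\<^sup>2) * indicator {-pi..pi} t \<partial>lborel)"
      unfolding multiplier_def by (rule nn_integral_circle) measurable
    also have "\<dots> \<le> (\<integral>\<^sup>+t. H t + H (- t) \<partial>lborel)"
    proof (rule nn_integral_mono)
      fix t :: real
      show "ennreal (log_kernel s t * (sin (real n * t / 2))\<^sup>2) * indicator {-pi..pi} t \<le> H t + H (- t)"
        using pointwise[of t] pointwise[of "- t", unfolded even]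
        by (cases "0 \<le> t") (auto simp: indicator_def intro: add_increasing add_increasing2)
    qed
    also have "\<dots> = (\<integral>\<^sup>+t. H t \<partial>lborel) + (\<integral>\<^sup>+t. H t \<partial>lborel)"
      using nn_integral_real_affine[of H "-1" 0] by (subst nn_integral_add) auto
    also have "(\<integral>\<^sup>+t. H t \<partial>lborel) = ennreal (C1 * C2 * n * B powr (2 * s)) * ennreal (1 / n)
        + ennreal C1 * ennreal (ln 2 / (2 * s) * (ell (1 / n) powr (2 * s) - ell pi powr (2 * s)))"
    proof -
      have "(\<integral>\<^sup>+t. H t \<partial>lborel) = (\<integral>\<^sup>+t. ennreal (C1 * C2 * n * B powr (2 * s)) * indicator {0..1 / real n} t \<partial>lborel)
        + ennreal C1 * (\<integral>\<^sup>+t. ennreal (psi t) * indicator {1 / real n..pi} t \<partial>lborel)"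
        unfolding H_def by (simp add: nn_integral_add nn_integral_cmult)
      also have "(\<integral>\<^sup>+t. ennreal (psi t) * indicator {1 / real n..pi} t \<partial>lborel) = 
          ennreal (ln 2 / (2 * s) * (ell (1 / n) powr (2 * s) - ell pi powr (2 * s)))"
        using n0 le_pi by (intro nn_integral_psi) auto
      also have "(\<integral>\<^sup>+t. ennreal (C1 * C2 * n * B powr (2 * s)) * indicator {0..1 / real n} t \<partial>lborel) =
          ennreal (C1 * C2 * n * B powr (2 * s)) * ennreal (1 / n)"
        by (subst nn_integral_cmult_indicator) auto
      finally show ?thesis .
    qed
    also have "\<dots> \<le> ennreal (C1 * C2 * B powr (2 * s)) + ennreal (C1 * (ln 2 / (2 * s) * B powr (2 * s)))"
    proof (rule add_mono)
      show "ennreal (C1 * C2 * n * B powr (2 * s)) * ennreal (1 / n) \<le> ennreal (C1 * C2 * B powr (2 * s))"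
        using n0 pos by (simp flip: ennreal_mult)
      have eB: "ell (1 / n) = B" by (simp add: B_def)
      have "ln 2 / (2 * s) * (B powr (2 * s) - ell pi powr (2 * s)) \<le> ln 2 / (2 * s) * B powr (2 * s)"
        using s by (intro mult_left_mono) auto
      then have "C1 * (ln 2 / (2 * s) * (B powr (2 * s) - ell pi powr (2 * s))) \<le> C1 * (ln 2 / (2 * s) * B powr (2 * s))"
        by (rule mult_left_mono) (use pos in auto)
      then show "ennreal C1 * ennreal (ln 2 / (2 * s) * (ell (1 / n) powr (2 * s) - ell pi powr (2 * s)))
         \<le> ennreal (C1 * (ln 2 / (2 * s) * B powr (2 * s)))"
        by (simp only: eB ennreal_mult'[OF less_imp_le[OF pos(1)], symmetric] ennreal_leI)
    qed
    also have "\<dots> = ennreal (C1 * D * B powr (2 * s))"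
      using pos s by (subst ennreal_plus[symmetric]) (auto simp: D_def distrib_left distrib_right mult_ac)
    finally have "multiplier s n \<le> ennreal (C1 * D * B powr (2 * s)) + ennreal (C1 * D * B powr (2 * s))"
      by (simp add: add_mono)
    also have "\<dots> = ennreal (2 * C1 * D * B powr (2 * s))"
      using pos by (subst ennreal_plus[symmetric]) auto
    also have "\<dots> \<le> ennreal (2 * C1 * D * (4 powr (2 * s) * log 2 (real n + 1) powr (2 * s)))"
    proof (intro ennreal_leI mult_left_mono)
      have "B powr (2 * s) \<le> (4 * log 2 (real n + 1)) powr (2 * s)" using B B1 s by (intro powr_mono2) auto
      also have "\<dots> = 4 powr (2 * s) * log 2 (real n + 1) powr (2 * s)" using n0 by (subst powr_mult) auto
      finally show "B powr (2 * s) \<le> 4 powr (2 * s) * log 2 (real n + 1) powr (2 * s)" .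
    qed (use pos in auto)
    finally show ?thesis by (simp add: mult_ac)
  qed
  show ?thesis
    by (rule exI[of _ "2 * C1 * D * 4 powr (2 * s)"]) (use main pos in auto)
qed

text \<open>
  Reduces the lower bound to \<open>\<psi>\<close>; by positivity only half of the period is kept.
\<close>

lemma multiplier_ge_psi:
  assumes "0 \<le> c" and c: "\<And>n. n \<ge> 1 \<Longrightarrow> ennreal (c * log 2 (real n + 1) powr (2 * s))
      \<le> (\<integral>\<^sup>+t. ennreal (psi t * (sin (real n * t / 2))\<^sup>2) * indicator {0..pi} t \<partial>lborel)"
  shows "\<forall>n\<ge>1. ennreal (2 / 2 powr \<bar>2 * s - 1\<bar> * c * log 2 (real n + 1) powr (2 * s)) \<le> multiplier s n"
proof (intro allI impI)
  fix n :: nat assume n: "n \<ge> 1"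
  let ?c = "2 / 2 powr \<bar>2 * s - 1\<bar>"
  have "ennreal (?c * c * log 2 (real n + 1) powr (2 * s)) = ennreal ?c * ennreal (c * log 2 (real n + 1) powr (2 * s))"
    using assms(1) by (subst ennreal_mult[symmetric]) (auto simp: mult_ac)
  also have "\<dots> \<le> ennreal ?c * (\<integral>\<^sup>+t. ennreal (psi t * (sin (real n * t / 2))\<^sup>2) * indicator {0..pi} t \<partial>lborel)"
    by (intro mult_left_mono c n) auto
  also have "\<dots> = (\<integral>\<^sup>+t. ennreal ?c * (ennreal (psi t * (sin (real n * t / 2))\<^sup>2) * indicator {0..pi} t) \<partial>lborel)"
    by (subst nn_integral_cmult) auto
  also have "\<dots> \<le> (\<integral>\<^sup>+t. ennreal (log_kernel s t * (sin (real n * t / 2))\<^sup>2) * indicator {-pi..pi} t \<partial>lborel)"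
  proof (rule nn_integral_mono)
    fix t :: real
    show "ennreal ?c * (ennreal (psi t * (sin (real n * t / 2))\<^sup>2) * indicator {0..pi} t)
      \<le> ennreal (log_kernel s t * (sin (real n * t / 2))\<^sup>2) * indicator {-pi..pi} t"
    proof (cases "0 < t \<and> t \<le> pi")
      case True
      then have "?c * psi t * (sin (real n * t / 2))\<^sup>2 \<le> log_kernel s t * (sin (real n * t / 2))\<^sup>2"
        by (intro mult_right_mono log_kernel_comparable_psi) auto
      then show ?thesis using True by (simp add: mult_ac ennreal_leI flip: ennreal_mult)
    qed (auto simp: indicator_def)
  qed
  also have "\<dots> = multiplier s n"
    unfolding multiplier_def by (rule nn_integral_circle[symmetric]) measurable
  finally show "ennreal (?c * c * log 2 (real n + 1) powr (2 * s)) \<le> multiplier s n" .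
qed

text \<open>
  \<open>\<psi>\<close> need not be monotone when \<open>s\<close> is small, but it is doubling: \<open>t + h\<close> lies between \<open>t\<close> and
  \<open>2 * t\<close>, where neither \<open>\<ell>\<close> nor \<open>1 / t\<close> changes by more than a factor \<open>2\<close>.
\<close>

lemma psi_shift:
  assumes "0 < h" "h \<le> t" "t \<le> pi / 2"
  shows "psi t / (2 * 2 powr \<bar>2 * s - 1\<bar>) \<le> psi (t + h)"
proof -
  have t: "0 < t" "t + h \<le> 2 * t" using assms by auto
  have l: "2 \<le> ell t" using assms t by (intro two_le_ell) auto
  have "ell t = log 2 (2 * (2 * pi / (2 * t)))" by simp
  also have "\<dots> = 1 + log 2 (2 * pi / (2 * t))" using t by (subst log_mult) auto
  finally have "ell t - 1 = log 2 (2 * pi / (2 * t))" by simp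
  also have "\<dots> \<le> ell (t + h)"
  proof -
    have "2 * pi / (2 * t) \<le> 2 * pi / (t + h)" using t assms by (intro divide_left_mono) simp_all
    then show ?thesis using t by (intro log_mono) auto
  qed
  finally have 1: "ell t \<le> 2 * ell (t + h)" using l by linarith
  have 2: "ell (t + h) \<le> 2 * ell t"
  proof -
    have "ell (t + h) \<le> ell t" using t assms by (subst log_le_cancel_iff) (auto intro!: divide_left_mono)
    then show ?thesis using l by linarith
  qed
  have "ell t powr (2 * s - 1) \<le> 2 powr \<bar>2 * s - 1\<bar> * ell (t + h) powr (2 * s - 1)"
    using 1 2 l by (intro powr_le_of_comparable) auto
  then have "ell t powr (2 * s - 1) / 2 powr \<bar>2 * s - 1\<bar> / (2 * t) \<le> ell (t + h) powr (2 * s - 1) / (t + h)"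
    using t assms by (intro frac_le) (auto simp: field_simps)
  then show ?thesis by (simp add: mult_ac)
qed

text \<open>
  The integral over \<open>[0, pi]\<close> dominates both the integral over \<open>[h, pi / 2]\<close> and the one over its
  translate by \<open>h = pi / n\<close>. On adding the two, \<open>sin\<^sup>2 + cos\<^sup>2 = 1\<close> leaves a multiple of the integral
  of \<open>\<psi>\<close> over \<open>[h, pi / 2]\<close>, which is a difference of powers of \<open>\<ell>(h) = log 2 (2 * n)\<close> and
  \<open>\<ell>(pi / 2) = 2\<close>. For \<open>n \<ge> 4\<close> the first is at least \<open>3\<close>, so the difference is a fixed fraction of
  the larger power.
\<close>

lemma nn_integral_psi_sin_lower_large:
  assumes n: "n \<ge> (4::nat)"
  shows "ennreal (ln 2 * (1 - (2 / 3) powr (2 * s)) / (8 * s * 2 powr \<bar>2 * s - 1\<bar>) * log 2 (real n + 1) powr (2 * s))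
      \<le> (\<integral>\<^sup>+t. ennreal (psi t * (sin (real n * t / 2))\<^sup>2) * indicator {0..pi} t \<partial>lborel)" (is "_ \<le> ?J")
proof -
  let ?a = "2 powr \<bar>2 * s - 1\<bar>"
  let ?G = "\<lambda>t. ennreal (psi t * (sin (real n * t / 2))\<^sup>2)"
  define h where "h = pi / n"
  have n0: "4 \<le> real n" using n by simp
  have h: "0 < h" "h \<le> pi / 4" using n0 by (auto simp: h_def field_simps)
  have a1: "1 \<le> ?a" by (simp add: ge_one_powr_ge_zero)
  have sc: "(sin (real n * (t + h) / 2))\<^sup>2 = (cos (real n * t / 2))\<^sup>2" for t
  proof -
    have "real n * (t + h) / 2 = real n * t / 2 + pi / 2" using n0 by (simp add: h_def field_simps)
    then show ?thesis by (simp only: sin_add) simp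
  qed
  have J1: "(\<integral>\<^sup>+t. ?G t * indicator {h..pi / 2} t \<partial>lborel) \<le> ?J"
    using h by (intro nn_integral_mono mult_left_mono) (auto simp: indicator_def)
  have J2: "(\<integral>\<^sup>+t. ?G (t + h) * indicator {h..pi / 2} t \<partial>lborel) \<le> ?J"
  proof -
    have "?J = (\<integral>\<^sup>+t. ?G (h + 1 * t) * indicator {0..pi} (h + 1 * t) \<partial>lborel)"
      by (subst nn_integral_real_affine[where c = 1 and t = h]) auto
    also have "\<dots> \<ge> (\<integral>\<^sup>+t. ?G (t + h) * indicator {h..pi / 2} t \<partial>lborel)"
      using h by (intro nn_integral_mono) (auto simp: indicator_def add.commute)
    finally show ?thesis .
  qed
  have "ennreal (1 / (2 * ?a)) * (\<integral>\<^sup>+t. ennreal (psi t) * indicator {h..pi / 2} t \<partial>lborel)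
      = (\<integral>\<^sup>+t. ennreal (1 / (2 * ?a)) * (ennreal (psi t) * indicator {h..pi / 2} t) \<partial>lborel)"
    by (subst nn_integral_cmult) auto
  also have "\<dots> \<le> (\<integral>\<^sup>+t. ?G t * indicator {h..pi / 2} t + ?G (t + h) * indicator {h..pi / 2} t \<partial>lborel)"
  proof (rule nn_integral_mono)
    fix t :: real
    show "ennreal (1 / (2 * ?a)) * (ennreal (psi t) * indicator {h..pi / 2} t)
       \<le> ?G t * indicator {h..pi / 2} t + ?G (t + h) * indicator {h..pi / 2} t"
    proof (cases "t \<in> {h..pi / 2}")
      case True
      then have t: "h \<le> t" "t \<le> pi / 2" "0 < t" using h by auto
      have p0: "0 \<le> psi t" "0 \<le> psi (t + h)" using t h by auto
      define q where "q = psi t / (2 * ?a)"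
      have q1: "q \<le> psi t"
        using p0(1) a1 divide_left_mono[of 1 "2 * ?a" "psi t"] unfolding q_def by simp
      have q2: "q \<le> psi (t + h)" unfolding q_def by (rule psi_shift) (use h t in auto)
      have "q = q * (sin (real n * t / 2))\<^sup>2 + q * (cos (real n * t / 2))\<^sup>2"
        by (simp flip: distrib_left)
      also have "\<dots> \<le> psi t * (sin (real n * t / 2))\<^sup>2 + psi (t + h) * (sin (real n * (t + h) / 2))\<^sup>2"
        unfolding sc using q1 q2 by (intro add_mono mult_right_mono) auto
      finally have "ennreal q \<le> ?G t + ?G (t + h)"
        using t h by (subst ennreal_plus[symmetric]) (auto simp del: ennreal_plus intro!: ennreal_leI divide_nonneg_nonneg)
      moreover have "ennreal (1 / (2 * ?a)) * ennreal (psi t) = ennreal q"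
        using p0 by (subst ennreal_mult[symmetric]) (auto simp: q_def mult_ac)
      ultimately show ?thesis using True by simp
    qed simp
  qed
  also have "\<dots> = (\<integral>\<^sup>+t. ?G t * indicator {h..pi / 2} t \<partial>lborel) + (\<integral>\<^sup>+t. ?G (t + h) * indicator {h..pi / 2} t \<partial>lborel)"
    by (subst nn_integral_add) auto
  also have "\<dots> \<le> ?J + ?J" using J1 J2 by (rule add_mono)
  finally have "ennreal (1 / (2 * ?a)) * (\<integral>\<^sup>+t. ennreal (psi t) * indicator {h..pi / 2} t \<partial>lborel) \<le> ?J + ?J" .
  moreover have "(\<integral>\<^sup>+t. ennreal (psi t) * indicator {h..pi / 2} t \<partial>lborel)
      = ennreal (ln 2 / (2 * s) * (ell h powr (2 * s) - ell (pi / 2) powr (2 * s)))"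
    using h by (intro nn_integral_psi) auto
  moreover have "ell (pi / 2) = 2" using log_nat_power[of 2 2 2] by simp
  moreover have "ell h = log 2 (2 * real n)" using n0 by (simp add: h_def)
  ultimately have 1: "ennreal (1 / (2 * ?a)) * ennreal (ln 2 / (2 * s) * (log 2 (2 * real n) powr (2 * s) - 2 powr (2 * s))) \<le> ?J + ?J"
    by simp
  define l where "l = log 2 (real n + 1)"
  have l3: "3 \<le> log 2 (2 * real n)" using n0 by (subst le_log_iff) auto
  have l: "0 \<le> l" "l \<le> log 2 (2 * real n)" unfolding l_def using n0 by auto
  have "(1 - (2 / 3) powr (2 * s)) * l powr (2 * s) \<le> (1 - (2 / 3) powr (2 * s)) * log 2 (2 * real n) powr (2 * s)"
    using l s by (intro mult_left_mono powr_mono2) (auto intro!: powr_le1)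
  also have "\<dots> = log 2 (2 * real n) powr (2 * s) - (2 / 3 * log 2 (2 * real n)) powr (2 * s)"
    using l3 by (subst powr_mult) (auto simp: algebra_simps)
  also have "\<dots> \<le> log 2 (2 * real n) powr (2 * s) - 2 powr (2 * s)"
    using l3 s by (intro diff_left_mono powr_mono2) auto
  finally have 2: "(1 - (2 / 3) powr (2 * s)) * l powr (2 * s) \<le> log 2 (2 * real n) powr (2 * s) - 2 powr (2 * s)" .
  define x where "x = ln 2 * (1 - (2 / 3) powr (2 * s)) / (8 * s * ?a) * l powr (2 * s)"
  have "2 * x = 1 / (2 * ?a) * (ln 2 / (2 * s) * ((1 - (2 / 3) powr (2 * s)) * l powr (2 * s)))"
    using s by (simp add: x_def field_simps)
  also have "\<dots> \<le> 1 / (2 * ?a) * (ln 2 / (2 * s) * (log 2 (2 * real n) powr (2 * s) - 2 powr (2 * s)))"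
    using 2 s by (intro mult_left_mono) auto
  finally have "ennreal (2 * x) \<le> ennreal (1 / (2 * ?a)) * ennreal (ln 2 / (2 * s) * (log 2 (2 * real n) powr (2 * s) - 2 powr (2 * s)))"
    by (subst ennreal_mult'[symmetric]) (auto intro: ennreal_leI)
  then have "ennreal (2 * x) \<le> ?J + ?J" using 1 by (rule order_trans)
  then have "ennreal x \<le> ?J" by (rule ennreal_le_of_double_le)
  then show ?thesis unfolding x_def l_def .
qed

text \<open>
  The difference of powers above degenerates for \<open>n \<le> 2\<close>. For small \<open>n\<close> it suffices to keep the
  interval \<open>[pi / (2 * n), pi / n]\<close>, on which \<open>sin\<^sup>2 \<ge> 1 / 2\<close> and \<open>\<psi>\<close> is nearly constant; the missing
  factor \<open>log 2 (2 * n)\<close> is at most \<open>3\<close>.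
\<close>

lemma nn_integral_psi_sin_lower_small:
  assumes n: "n \<ge> 1" "n < (4::nat)"
  shows "ennreal (1 / (12 * 2 powr \<bar>2 * s - 1\<bar>) * log 2 (real n + 1) powr (2 * s))
      \<le> (\<integral>\<^sup>+t. ennreal (psi t * (sin (real n * t / 2))\<^sup>2) * indicator {0..pi} t \<partial>lborel)" (is "_ \<le> ?J")
proof -
  let ?a = "2 powr \<bar>2 * s - 1\<bar>"
  define h where "h = pi / n"
  have n0: "1 \<le> real n" "real n < 4" using n by auto
  have h: "0 < h" "h \<le> pi" using n0 by (auto simp: h_def field_simps)
  define l where "l = log 2 (2 * real n)"
  have lh: "ell h = l" using n0 by (simp add: h_def l_def)
  have l1: "1 \<le> l" unfolding l_def using n0 by (subst le_log_iff) auto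
  have "l \<le> log 2 8" unfolding l_def using n0 by (subst log_le_cancel_iff) auto
  then have l3: "l \<le> 3" using log_nat_power[of 2 2 3] by simp
  have "log 2 (real n + 1) \<le> l" unfolding l_def using n0 by auto
  then have "log 2 (real n + 1) powr (2 * s) \<le> l powr (2 * s)" using s n0 by (intro powr_mono2) auto
  also have "\<dots> = l * l powr (2 * s - 1)" using l1 powr_add[of l 1 "2 * s - 1"] by simp
  also have "\<dots> \<le> 3 * l powr (2 * s - 1)" using l3 by (intro mult_right_mono) auto
  finally have "1 / (12 * ?a) * log 2 (real n + 1) powr (2 * s) \<le> 1 / (12 * ?a) * (3 * l powr (2 * s - 1))"
    by (intro mult_left_mono) auto
  also have "\<dots> = (l powr (2 * s - 1) / ?a / h * (1 / 2)) * (h - h / 2)" using h by (simp add: field_simps)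
  finally have "ennreal (1 / (12 * ?a) * log 2 (real n + 1) powr (2 * s))
     \<le> ennreal ((l powr (2 * s - 1) / ?a / h * (1 / 2)) * (h - h / 2))" by (rule ennreal_leI)
  also have "\<dots> = (\<integral>\<^sup>+t. ennreal (l powr (2 * s - 1) / ?a / h * (1 / 2)) * indicator {h / 2..h} t \<partial>lborel)"
  proof -
    let ?A = "l powr (2 * s - 1) / ?a / h * (1 / 2)"
    have "(\<integral>\<^sup>+t. ennreal ?A * indicator {h / 2..h} t \<partial>lborel) = ennreal ?A * emeasure lborel {h / 2..h}"
      by (rule nn_integral_cmult_indicator) simp
    also have "emeasure lborel {h / 2..h} = ennreal (h - h / 2)"
      by (rule emeasure_lborel_Icc) (use h in auto)
    also have "ennreal ?A * ennreal (h - h / 2) = ennreal (?A * (h - h / 2))"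
      by (rule ennreal_mult'[symmetric]) (use h in auto)
    finally show ?thesis by (rule sym)
  qed
  also have "\<dots> \<le> ?J"
  proof (rule nn_integral_mono)
    fix t :: real
    show "ennreal (l powr (2 * s - 1) / ?a / h * (1 / 2)) * indicator {h / 2..h} t
      \<le> ennreal (psi t * (sin (real n * t / 2))\<^sup>2) * indicator {0..pi} t"
    proof (cases "t \<in> {h / 2..h}")
      case True
      then have t: "h / 2 \<le> t" "t \<le> h" "0 < t" using h by auto
      have nt: "pi / 4 \<le> real n * t / 2" "real n * t / 2 \<le> pi / 2" using t n0 by (auto simp: h_def field_simps)
      have "sin (pi / 4) \<le> sin (real n * t / 2)" using nt by (intro sin_monotone_2pi_le) auto
      then have "(sqrt 2 / 2)\<^sup>2 \<le> (sin (real n * t / 2))\<^sup>2" by (intro power_mono) (auto simp: sin_45)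
      then have s2: "1 / 2 \<le> (sin (real n * t / 2))\<^sup>2" by (simp add: power_divide)
      have 1: "l \<le> ell t" unfolding lh[symmetric] using t h by (subst log_le_cancel_iff) (auto intro!: divide_left_mono)
      have "2 * pi / t \<le> 2 * pi / (h / 2)" using t h by (intro divide_left_mono) simp_all
      then have "ell t \<le> log 2 (2 * pi / (h / 2))" using t by (intro log_mono) auto
      also have "2 * pi / (h / 2) = 2 * (2 * pi / h)" by simp
      also have "log 2 (2 * (2 * pi / h)) = 1 + l" unfolding lh[symmetric] using h by (subst log_mult) auto
      finally have 2: "ell t \<le> 2 * l" using l1 by linarith
      have "l powr (2 * s - 1) \<le> ?a * ell t powr (2 * s - 1)" using 1 2 l1 by (intro powr_le_of_comparable) auto
      then have "l powr (2 * s - 1) / ?a / h \<le> psi t" using t h by (intro frac_le) (auto simp: field_simps)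
      then have "l powr (2 * s - 1) / ?a / h * (1 / 2) \<le> psi t * (sin (real n * t / 2))\<^sup>2"
        using s2 t h by (intro mult_mono) auto
      then show ?thesis using True t h by (simp add: ennreal_leI)
    qed simp
  qed
  finally show ?thesis .
qed

lemma multiplier_lower:
  "\<exists>k>0. \<forall>n\<ge>1. ennreal (k * log 2 (real n + 1) powr (2 * s)) \<le> multiplier s n"
proof -
  let ?a = "2 powr \<bar>2 * s - 1\<bar>"
  define c1 where "c1 = ln 2 * (1 - (2 / 3) powr (2 * s)) / (8 * s * ?a)"
  define c2 where "c2 = 1 / (12 * ?a)"
  define c where "c = min c1 c2"
  have "(2 / 3) powr (2 * s) < (1::real)" using s powr_less_mono2[of "2 * s" "2 / 3" 1] by simp
  then have c: "0 < c" using s by (auto simp: c_def c1_def c2_def)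
  have "\<forall>n\<ge>1. ennreal (2 / ?a * c * log 2 (real n + 1) powr (2 * s)) \<le> multiplier s n"
  proof (rule multiplier_ge_psi)
    fix n :: nat assume n: "n \<ge> 1"
    have "ennreal (c * log 2 (real n + 1) powr (2 * s)) \<le> ennreal ((if n \<ge> 4 then c1 else c2) * log 2 (real n + 1) powr (2 * s))"
      by (intro ennreal_leI mult_right_mono) (auto simp: c_def)
    also have "\<dots> \<le> (\<integral>\<^sup>+t. ennreal (psi t * (sin (real n * t / 2))\<^sup>2) * indicator {0..pi} t \<partial>lborel)"
      using nn_integral_psi_sin_lower_large[of n] nn_integral_psi_sin_lower_small[of n] n
      by (simp add: c1_def c2_def)
    finally show "ennreal (c * log 2 (real n + 1) powr (2 * s))
      \<le> (\<integral>\<^sup>+t. ennreal (psi t * (sin (real n * t / 2))\<^sup>2) * indicator {0..pi} t \<partial>lborel)" .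
  qed (use c in auto)
  then show ?thesis using c by (intro exI[of _ "2 / ?a * c"]) auto
qed

end

section \<open>Periodic functions and translation\<close>

lemma periodic_add_int:
  fixes F :: "real \<Rightarrow> 'a"
  assumes "\<And>x. F (x + 2 * pi) = F x"
  shows "F (x + 2 * pi * of_int k) = F x"
proof -
  have nat: "F (y + 2 * pi * real n) = F y" for y n
  proof (induction n)
    case (Suc n)
    have "y + 2 * pi * real (Suc n) = (y + 2 * pi * real n) + 2 * pi" by (simp add: algebra_simps)
    then show ?case using assms[of "y + 2 * pi * real n"] Suc by (simp only:)
  qed simp
  show ?thesis
  proof (cases "k \<ge> 0")
    case True
    then show ?thesis using nat[of x "nat k"] by simp
  next
    case False
    then show ?thesis using nat[of "x + 2 * pi * of_int k" "nat (- k)"] by simp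
  qed
qed

text \<open>
  Every window of length \<open>2 * pi\<close> contains some \<open>m = 2 * pi * k - pi\<close>. Moving the part to the left of
  \<open>m\<close> by one period turns the window into \<open>[m, m + 2 * pi)\<close>, a translate of \<open>[- pi, pi)\<close> by a multiple
  of the period.
\<close>

lemma nn_integral_period_translate:
  fixes F :: "real \<Rightarrow> ennreal"
  assumes F [measurable]: "F \<in> borel_measurable borel" and per: "\<And>x. F (x + 2 * pi) = F x"
  shows "(\<integral>\<^sup>+x. F x * indicator {a..<a + 2 * pi} x \<partial>lborel)
    = (\<integral>\<^sup>+x. F x * indicator {-pi..<pi} x \<partial>lborel)"
proof -
  have shift: "(\<integral>\<^sup>+x. F x * indicator {b..<c} x \<partial>lborel)
      = (\<integral>\<^sup>+x. F x * indicator {b - 2 * pi * of_int k..<c - 2 * pi * of_int k} x \<partial>lborel)" for b c k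
    by (subst nn_integral_real_affine[where c = 1 and t = "2 * pi * of_int k"])
      (auto intro!: nn_integral_cong simp: indicator_def periodic_add_int[of F, OF per, of _ k] add.commute[of "2 * pi * of_int k"] split: if_splits)
  \<comment> \<open>The smallest \<open>k\<close> for which \<open>m\<close> is not to the left of the window.\<close>
  define k where "k = \<lceil>(a + pi) / (2 * pi)\<rceil>"
  define m where "m = 2 * pi * of_int k - pi"
  have "(a + pi) / (2 * pi) \<le> of_int k" "of_int k < (a + pi) / (2 * pi) + 1" unfolding k_def by linarith+
  then have m: "a \<le> m" "m < a + 2 * pi" unfolding m_def by (auto simp: field_simps)
  have "(\<integral>\<^sup>+x. F x * indicator {a..<a + 2 * pi} x \<partial>lborel)
     = (\<integral>\<^sup>+x. F x * indicator {a..<m} x + F x * indicator {m..<a + 2 * pi} x \<partial>lborel)"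
    using m by (intro nn_integral_cong) (auto simp: indicator_def)
  also have "\<dots> = (\<integral>\<^sup>+x. F x * indicator {a..<m} x \<partial>lborel) + (\<integral>\<^sup>+x. F x * indicator {m..<a + 2 * pi} x \<partial>lborel)"
    by (rule nn_integral_add) measurable
  also have "(\<integral>\<^sup>+x. F x * indicator {a..<m} x \<partial>lborel) = (\<integral>\<^sup>+x. F x * indicator {a + 2 * pi..<m + 2 * pi} x \<partial>lborel)"
    using shift[of a m "-1"] by simp
  also have "\<dots> + (\<integral>\<^sup>+x. F x * indicator {m..<a + 2 * pi} x \<partial>lborel) =
      (\<integral>\<^sup>+x. F x * indicator {a + 2 * pi..<m + 2 * pi} x + F x * indicator {m..<a + 2 * pi} x \<partial>lborel)"
    by (rule nn_integral_add[symmetric]) measurable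
  also have "\<dots> = (\<integral>\<^sup>+x. F x * indicator {m..<m + 2 * pi} x \<partial>lborel)"
    using m by (intro nn_integral_cong) (auto simp: indicator_def)
  also have "\<dots> = (\<integral>\<^sup>+x. F x * indicator {-pi..<pi} x \<partial>lborel)"
    using shift[of m "m + 2 * pi" k] by (simp add: m_def)
  finally show ?thesis .
qed

lemma nn_integral_circle_half_open:
  fixes F :: "real \<Rightarrow> ennreal"
  assumes [measurable]: "F \<in> borel_measurable borel"
  shows "(\<integral>\<^sup>+t. F t \<partial>circle_measure) = (\<integral>\<^sup>+t. F t * indicator {-pi..<pi} t \<partial>lborel)"
  unfolding nn_integral_circle[OF assms]
  by (intro nn_integral_cong_AE eventually_mono[OF AE_lborel_singleton[of pi]]) (auto simp: indicator_def)

lemma nn_integral_circle_shift: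
  fixes F :: "real \<Rightarrow> ennreal"
  assumes [measurable]: "F \<in> borel_measurable borel" and per: "\<And>x. F (x + 2 * pi) = F x"
  shows "(\<integral>\<^sup>+x. F (x + v) \<partial>circle_measure) = (\<integral>\<^sup>+x. F x \<partial>circle_measure)"
proof -
  have "(\<integral>\<^sup>+x. F (x + v) \<partial>circle_measure) = (\<integral>\<^sup>+x. F (x + v) * indicator {-pi..<pi} x \<partial>lborel)"
    by (rule nn_integral_circle_half_open) measurable
  also have "\<dots> = (\<integral>\<^sup>+x. F x * indicator {v - pi..<v - pi + 2 * pi} x \<partial>lborel)"
    by (subst (2) nn_integral_real_affine[where c = 1 and t = v])
      (auto intro!: nn_integral_cong simp: indicator_def add.commute)
  also have "\<dots> = (\<integral>\<^sup>+x. F x \<partial>circle_measure)"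
    by (simp only: nn_integral_period_translate[of F, OF assms(1) per] nn_integral_circle_half_open[OF assms(1)])
  finally show ?thesis .
qed

text \<open>
  Reduction modulo \<open>2 * pi\<close> to the fundamental domain \<open>[- pi, pi)\<close>.
\<close>

definition wrap :: "real \<Rightarrow> real" where
  "wrap x = x - 2 * pi * of_int \<lfloor>(x + pi) / (2 * pi)\<rfloor>"

lemma borel_measurable_wrap [measurable]: "wrap \<in> borel_measurable borel"
  unfolding wrap_def[abs_def] by measurable

lemma wrap_eq: "x \<in> {-pi..<pi} \<Longrightarrow> wrap x = x"
proof -
  assume "x \<in> {-pi..<pi}"
  then have "\<lfloor>(x + pi) / (2 * pi)\<rfloor> = 0" by (simp add: floor_eq_iff field_simps)
  then show ?thesis by (simp add: wrap_def)
qed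

lemma wrap_periodic: "wrap (x + 2 * pi) = wrap x"
proof -
  have "(x + 2 * pi + pi) / (2 * pi) = (x + pi) / (2 * pi) + 1" by (simp add: field_simps)
  then show ?thesis by (simp add: wrap_def algebra_simps)
qed

lemma periodic_wrap:
  assumes "\<And>x. F (x + 2 * pi) = F x"
  shows "F (wrap x) = F x"
  using periodic_add_int[of F x "- \<lfloor>(x + pi) / (2 * pi)\<rfloor>", OF assms] by (simp add: wrap_def)

text \<open>
  Translation invariance of nonnegative integrals says that \<open>wrap (x + v)\<close> and \<open>wrap x\<close> have the same
  distribution; integrals of vector-valued functions only depend on this distribution.
\<close>

lemma integral_circle_shift:
  fixes F :: "real \<Rightarrow> 'b::{banach, second_countable_topology}"
  assumes F [measurable]: "F \<in> borel_measurable borel" and per: "\<And>x. F (x + 2 * pi) = F x"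
  shows "(LINT x|circle_measure. F (x + v)) = (LINT x|circle_measure. F x)"
proof -
  have m: "(\<lambda>x. wrap (x + v)) \<in> circle_measure \<rightarrow>\<^sub>M borel" for v
    by (rule borel_measurable_circle) measurable
  have "distr circle_measure borel (\<lambda>x. wrap (x + v)) = distr circle_measure borel (\<lambda>x. wrap (x + 0))"
  proof (rule measure_eqI)
    fix A assume "A \<in> sets (distr circle_measure borel (\<lambda>x. wrap (x + v)))"
    then have A [measurable]: "A \<in> sets borel" by simp
    have "emeasure (distr circle_measure borel (\<lambda>x. wrap (x + v))) A = (\<integral>\<^sup>+x. indicator A (wrap x) \<partial>circle_measure)" for v
    proof -
      have "emeasure (distr circle_measure borel (\<lambda>x. wrap (x + v))) A
          = (\<integral>\<^sup>+x. indicator A x \<partial>distr circle_measure borel (\<lambda>x. wrap (x + v)))" by simp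
      also have "\<dots> = (\<integral>\<^sup>+x. indicator A (wrap (x + v)) \<partial>circle_measure)"
        by (rule nn_integral_distr[OF m]) measurable
      also have "\<dots> = (\<integral>\<^sup>+x. indicator A (wrap x) \<partial>circle_measure)"
        by (rule nn_integral_circle_shift[where F = "\<lambda>x. indicator A (wrap x)"]) (simp_all add: wrap_periodic)
      finally show ?thesis .
    qed
    then show "emeasure (distr circle_measure borel (\<lambda>x. wrap (x + v))) A
      = emeasure (distr circle_measure borel (\<lambda>x. wrap (x + 0))) A" by metis
  qed simp
  then have "(LINT x|distr circle_measure borel (\<lambda>x. wrap (x + v)). F x)
      = (LINT x|distr circle_measure borel (\<lambda>x. wrap (x + 0)). F x)" by (simp only:)
  then show ?thesis
    unfolding integral_distr[OF m F]
    by (simp only: periodic_wrap[of F, OF per] add_0_right)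
qed

text \<open>
  The joint measurability behind Tonelli's theorem, for functions of \<open>v + t\<close>, holds for Borel
  functions but not in general for Lebesgue measurable ones.
\<close>

lemma borel_periodic_representative:
  fixes f :: "real \<Rightarrow> real"
  assumes f: "f \<in> borel_measurable circle_measure"
  obtains g where "g \<in> borel_measurable borel" "\<And>x. g (x + 2 * pi) = g x" "AE x in circle_measure. f x = g x"
proof -
  have "(\<lambda>x. if x \<in> {-pi..pi} then f x else 0) \<in> borel_measurable lebesgue"
    using f by (subst borel_measurable_if) auto
  then obtain h where h [measurable]: "h \<in> borel_measurable lborel"
      and ae: "AE x in lborel. (if x \<in> {-pi..pi} then f x else 0) = h x"
    using completion_ex_borel_measurable_real by blast
  show ?thesis
  proof (rule that[of "\<lambda>x. h (wrap x)"])
    show "(\<lambda>x. h (wrap x)) \<in> borel_measurable borel" using h by measurable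
    show "h (wrap (x + 2 * pi)) = h (wrap x)" for x by (simp add: wrap_periodic)
    have "AE x in lebesgue. (if x \<in> {-pi..pi} then f x else 0) = h x" using ae by (rule AE_completion)
    then have "AE x in lebesgue. x \<in> {-pi..pi} \<longrightarrow> f x = h x" by eventually_elim auto
    then have "AE x in circle_measure. f x = h x" by (subst AE_restrict_space_iff) simp_all
    then show "AE x in circle_measure. f x = h (wrap x)"
      using AE_circle_not_pi by eventually_elim (simp add: wrap_eq)
  qed
qed

section \<open>The energy in Fourier space\<close>

lemma borel_measurable_circle_pair:
  assumes "F \<in> borel_measurable (borel \<Otimes>\<^sub>M borel)"
  shows "F \<in> borel_measurable (circle_measure \<Otimes>\<^sub>M circle_measure)"
proof -
  have id: "(\<lambda>x. x) \<in> circle_measure \<rightarrow>\<^sub>M borel" by (rule borel_measurable_circle) simp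
  have "(\<lambda>p. (fst p, snd p)) \<in> circle_measure \<Otimes>\<^sub>M circle_measure \<rightarrow>\<^sub>M borel \<Otimes>\<^sub>M borel"
    by (intro measurable_Pair measurable_compose[OF measurable_fst id] measurable_compose[OF measurable_snd id])
  from measurable_compose[OF this assms] show ?thesis by simp
qed

lemma pair_sigma_finite_circle: "pair_sigma_finite circle_measure circle_measure"
  using finite_measure.axioms(1)[OF finite_measure_circle] by (simp add: pair_sigma_finite_def)

lemma log_kernel_periodic: "log_kernel s (t + 2 * pi) = log_kernel s t"
proof -
  have "sin ((t + 2 * pi) / 2) = - sin (t / 2)" by (simp add: add_divide_distrib)
  then show ?thesis by (simp add: log_kernel_def)
qed

lemma cmod_cis_minus_one_squared: "(cmod (cis x - 1))\<^sup>2 = 4 * (sin (x / 2))\<^sup>2"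
proof -
  have "(cmod (cis x - 1))\<^sup>2 = (cos x - 1)\<^sup>2 + (sin x)\<^sup>2" by (simp add: cmod_power2)
  also have "\<dots> = 2 - 2 * cos x" using sin_cos_squared_add[of x] by (simp add: power2_diff) 
  also have "cos x = 1 - 2 * (sin (x / 2))\<^sup>2" using cos_double_sin[of "x / 2"] by simp
  finally show ?thesis by simp
qed

text \<open>
  Parseval's identity for \<open>g (v + t) - g v\<close>, whose coefficients are \<open>(cis (- n t) - 1) * c n\<close>.
\<close>

lemma nn_integral_translation_difference:
  fixes g :: "real \<Rightarrow> real"
  assumes g [measurable]: "g \<in> borel_measurable borel" and per: "\<And>x. g (x + 2 * pi) = g x"
    and sq: "integrable circle_measure (\<lambda>t. (g t)\<^sup>2)"
  defines "c \<equiv> \<lambda>n. (LINT t|circle_measure. complex_of_real (g t) * cis (real n * t))"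
  shows "(\<integral>\<^sup>+v. ennreal ((g (v + t) - g v)\<^sup>2) \<partial>circle_measure)
    = (\<Sum>n. ennreal (4 / pi * (cmod (c n))\<^sup>2) * ennreal ((sin (real n * t / 2))\<^sup>2))"
proof -
  have g' [measurable]: "(\<lambda>v. g (v + t)) \<in> borel_measurable borel" by measurable
  let ?w = "\<lambda>v. g (v + t) - g v"
  have sqt: "integrable circle_measure (\<lambda>v. (g (v + t))\<^sup>2)"
  proof (rule integrableI_bounded)
    show "(\<lambda>v. (g (v + t))\<^sup>2) \<in> borel_measurable circle_measure" by (rule borel_measurable_circle) measurable
    have "(\<integral>\<^sup>+v. ennreal (norm ((g (v + t))\<^sup>2)) \<partial>circle_measure) = (\<integral>\<^sup>+v. ennreal (norm ((g v)\<^sup>2)) \<partial>circle_measure)"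
      by (rule nn_integral_circle_shift[where F = "\<lambda>v. ennreal (norm ((g v)\<^sup>2))"]) (simp_all add: per)
    then show "(\<integral>\<^sup>+v. ennreal (norm ((g (v + t))\<^sup>2)) \<partial>circle_measure) < \<infinity>"
      using sq by (simp add: integrable_iff_bounded)
  qed
  have gi: "integrable circle_measure g"
    by (rule integrable_of_square_integrable[OF borel_measurable_circle[OF g] sq])
  have gti: "integrable circle_measure (\<lambda>v. g (v + t))"
    by (rule integrable_of_square_integrable[OF borel_measurable_circle[OF g'] sqt])
  have wm: "?w \<in> borel_measurable borel" by measurable
  have wi: "integrable circle_measure (\<lambda>v. (?w v)\<^sup>2)"
  proof (rule Bochner_Integration.integrable_bound)
    show "integrable circle_measure (\<lambda>v. 2 * (g (v + t))\<^sup>2 + 2 * (g v)\<^sup>2)" using sq sqt by simp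
    have "(a - b)\<^sup>2 \<le> 2 * a\<^sup>2 + 2 * b\<^sup>2" for a b :: real
      using zero_le_power2[of "a + b"] by (simp add: power2_sum power2_diff)
    then show "AE v in circle_measure. norm ((?w v)\<^sup>2) \<le> norm (2 * (g (v + t))\<^sup>2 + 2 * (g v)\<^sup>2)"
      by (intro always_eventually allI) (simp add: abs_of_nonneg)
    show "(\<lambda>v. (?w v)\<^sup>2) \<in> borel_measurable circle_measure" by (rule borel_measurable_circle) measurable
  qed
  have coeff: "(LINT v|circle_measure. complex_of_real (?w v) * cis (real n * v)) = (cis (- (real n * t)) - 1) * c n" for n
  proof -
    have p: "cis (real n * (v + 2 * pi)) = cis (real n * v)" for v
    proof -
      have "cis (real n * (v + 2 * pi)) = cis (real n * v) * cis (2 * pi * of_int (int n))"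
        by (simp add: cis_mult algebra_simps)
      then show ?thesis by (simp add: cis_multiple_2pi)
    qed
    have cm: "(\<lambda>v. cis (real n * v)) \<in> borel_measurable borel"
      by (intro borel_measurable_continuous_onI continuous_intros)
    have e: "complex_of_real (g (v + t)) * cis (real n * v)
        = cis (- (real n * t)) * (complex_of_real (g (v + t)) * cis (real n * (v + t)))" for v
    proof -
      have "cis (real n * v) = cis (- (real n * t)) * cis (real n * (v + t))"
        by (simp add: cis_mult algebra_simps)
      then show ?thesis by (simp add: mult_ac)
    qed
    have "(LINT v|circle_measure. complex_of_real (?w v) * cis (real n * v))
       = (LINT v|circle_measure. complex_of_real (g (v + t)) * cis (real n * v)) - c n"
      unfolding c_def
      by (subst Bochner_Integration.integral_diff[symmetric])
        (auto intro!: integrable_circle_cis_mult gi gti simp: left_diff_distrib)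
    also have "(LINT v|circle_measure. complex_of_real (g (v + t)) * cis (real n * v))
       = cis (- (real n * t)) * (LINT v|circle_measure. complex_of_real (g (v + t)) * cis (real n * (v + t)))"
      unfolding e by (rule integral_mult_right_zero)
    also have "(LINT v|circle_measure. complex_of_real (g (v + t)) * cis (real n * (v + t))) = c n"
      unfolding c_def
    proof (rule integral_circle_shift[where F = "\<lambda>v. complex_of_real (g v) * cis (real n * v)"])
      show "(\<lambda>v. complex_of_real (g v) * cis (real n * v)) \<in> borel_measurable borel"
        using cm by measurable
    qed (simp only: per p)
    finally show ?thesis by (simp add: left_diff_distrib)
  qed
  have "(\<lambda>n. (if n = 0 then 1 else 2) * (cmod ((cis (- (real n * t)) - 1) * c n))\<^sup>2) sums
      (2 * pi * (LINT v|circle_measure. (?w v)\<^sup>2))"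
    using Parseval_real[OF wm wi] unfolding coeff .
  then have "(\<lambda>n. (if n = 0 then 1 else 2) * (cmod ((cis (- (real n * t)) - 1) * c n))\<^sup>2 / (2 * pi)) sums
      (2 * pi * (LINT v|circle_measure. (?w v)\<^sup>2) / (2 * pi))" by (rule sums_divide)
  also have "(\<lambda>n. (if n = 0 then 1 else 2) * (cmod ((cis (- (real n * t)) - 1) * c n))\<^sup>2 / (2 * pi))
      = (\<lambda>n. 4 / pi * (cmod (c n))\<^sup>2 * (sin (real n * t / 2))\<^sup>2)"
  proof
    fix n
    have "(cmod ((cis (- (real n * t)) - 1) * c n))\<^sup>2 = 4 * (sin (real n * t / 2))\<^sup>2 * (cmod (c n))\<^sup>2"
      by (simp only: norm_mult power_mult_distrib cmod_cis_minus_one_squared) simp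
    then show "(if n = 0 then 1 else 2) * (cmod ((cis (- (real n * t)) - 1) * c n))\<^sup>2 / (2 * pi)
        = 4 / pi * (cmod (c n))\<^sup>2 * (sin (real n * t / 2))\<^sup>2"
      by (cases "n = 0") simp_all
  qed
  finally have sums: "(\<lambda>n. 4 / pi * (cmod (c n))\<^sup>2 * (sin (real n * t / 2))\<^sup>2) sums (LINT v|circle_measure. (?w v)\<^sup>2)"
    by simp
  have "(\<integral>\<^sup>+v. ennreal ((?w v)\<^sup>2) \<partial>circle_measure) = ennreal (LINT v|circle_measure. (?w v)\<^sup>2)"
    by (rule nn_integral_eq_integral[OF wi]) simp
  also have "\<dots> = (\<Sum>n. ennreal (4 / pi * (cmod (c n))\<^sup>2 * (sin (real n * t / 2))\<^sup>2))"
    by (rule suminf_ennreal_eq[OF _ sums, symmetric]) simp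
  also have "\<dots> = (\<Sum>n. ennreal (4 / pi * (cmod (c n))\<^sup>2) * ennreal ((sin (real n * t / 2))\<^sup>2))"
    by (intro suminf_cong ennreal_mult) simp_all
  finally show ?thesis .
qed

text \<open>
  The integrand has period \<open>2 * pi\<close> in \<open>u\<close>, so \<open>u = v + t\<close> with \<open>t\<close> in the fundamental domain is a
  valid substitution; after exchanging the integrals, the inner one is the preceding lemma.
\<close>

lemma energy_eq_multiplier_sum:
  fixes g :: "real \<Rightarrow> real"
  assumes g [measurable]: "g \<in> borel_measurable borel" and per: "\<And>x. g (x + 2 * pi) = g x"
    and sq: "integrable circle_measure (\<lambda>t. (g t)\<^sup>2)"
  defines "c \<equiv> \<lambda>n. (LINT t|circle_measure. complex_of_real (g t) * cis (real n * t))"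
  shows "(\<integral>\<^sup>+v. \<integral>\<^sup>+u. ennreal ((g u - g v)\<^sup>2 * log_kernel s (u - v)) \<partial>circle_measure \<partial>circle_measure)
    = (\<Sum>n. ennreal (4 / pi * (cmod (c n))\<^sup>2) * multiplier s n)"
proof -
  interpret pair_sigma_finite circle_measure circle_measure by (rule pair_sigma_finite_circle)
  have "(\<integral>\<^sup>+v. \<integral>\<^sup>+u. ennreal ((g u - g v)\<^sup>2 * log_kernel s (u - v)) \<partial>circle_measure \<partial>circle_measure)
     = (\<integral>\<^sup>+v. \<integral>\<^sup>+t. ennreal ((g (t + v) - g v)\<^sup>2 * log_kernel s (t + v - v)) \<partial>circle_measure \<partial>circle_measure)"
  proof (rule nn_integral_cong)
    fix v
    have "log_kernel s (x + 2 * pi - v) = log_kernel s (x - v)" for x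
      using log_kernel_periodic[of s "x - v"] by (simp add: algebra_simps)
    then show "(\<integral>\<^sup>+u. ennreal ((g u - g v)\<^sup>2 * log_kernel s (u - v)) \<partial>circle_measure)
      = (\<integral>\<^sup>+t. ennreal ((g (t + v) - g v)\<^sup>2 * log_kernel s (t + v - v)) \<partial>circle_measure)"
      by (intro nn_integral_circle_shift[symmetric]) (simp_all add: per)
  qed
  also have "\<dots> = (\<integral>\<^sup>+v. \<integral>\<^sup>+t. ennreal (log_kernel s t) * ennreal ((g (v + t) - g v)\<^sup>2) \<partial>circle_measure \<partial>circle_measure)"
    by (intro nn_integral_cong) (simp add: ennreal_mult[symmetric] log_kernel_nonneg mult.commute add.commute)
  also have "\<dots> = (\<integral>\<^sup>+t. \<integral>\<^sup>+v. ennreal (log_kernel s t) * ennreal ((g (v + t) - g v)\<^sup>2) \<partial>circle_measure \<partial>circle_measure)"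
    by (rule Fubini', rule borel_measurable_circle_pair) measurable
  also have "\<dots> = (\<integral>\<^sup>+t. ennreal (log_kernel s t) * (\<integral>\<^sup>+v. ennreal ((g (v + t) - g v)\<^sup>2) \<partial>circle_measure) \<partial>circle_measure)"
    by (intro nn_integral_cong nn_integral_cmult borel_measurable_circle) measurable
  also have "\<dots> = (\<integral>\<^sup>+t. (\<Sum>n. ennreal (4 / pi * (cmod (c n))\<^sup>2) * ennreal (log_kernel s t * (sin (real n * t / 2))\<^sup>2)) \<partial>circle_measure)"
  proof (rule nn_integral_cong)
    fix t
    have "ennreal (log_kernel s t) * (\<integral>\<^sup>+v. ennreal ((g (v + t) - g v)\<^sup>2) \<partial>circle_measure)
        = (\<Sum>n. ennreal (log_kernel s t) * (ennreal (4 / pi * (cmod (c n))\<^sup>2) * ennreal ((sin (real n * t / 2))\<^sup>2)))"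
      unfolding nn_integral_translation_difference[OF g per sq] c_def by (rule ennreal_suminf_cmult[symmetric])
    also have "\<dots> = (\<Sum>n. ennreal (4 / pi * (cmod (c n))\<^sup>2) * ennreal (log_kernel s t * (sin (real n * t / 2))\<^sup>2))"
      by (simp only: ennreal_mult'[OF log_kernel_nonneg] mult.left_commute)
    finally show "ennreal (log_kernel s t) * (\<integral>\<^sup>+v. ennreal ((g (v + t) - g v)\<^sup>2) \<partial>circle_measure)
        = (\<Sum>n. ennreal (4 / pi * (cmod (c n))\<^sup>2) * ennreal (log_kernel s t * (sin (real n * t / 2))\<^sup>2))" .
  qed
  also have "\<dots> = (\<Sum>n. \<integral>\<^sup>+t. ennreal (4 / pi * (cmod (c n))\<^sup>2) * ennreal (log_kernel s t * (sin (real n * t / 2))\<^sup>2) \<partial>circle_measure)"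
    by (intro nn_integral_suminf borel_measurable_circle) measurable
  also have "\<dots> = (\<Sum>n. ennreal (4 / pi * (cmod (c n))\<^sup>2) * multiplier s n)"
    unfolding multiplier_def
    by (intro suminf_cong nn_integral_cmult borel_measurable_circle) measurable
  finally show ?thesis .
qed

lemma L2_set_squared: "finite A \<Longrightarrow> (L2_set f A)\<^sup>2 = (\<Sum>i\<in>A. (f i)\<^sup>2)"
  by (simp add: L2_set_def sum_nonneg)

text \<open>
  The squared Euclidean norm splits the energy into its components.
\<close>

lemma L_energy_eq_multiplier_sum:
  assumes f: "in_L2 d f"
  shows "L_energy s d f
    = (\<Sum>n. ennreal (4 / pi * (L2_set (\<lambda>k. cmod (fourier_coeff f n k)) {1..d})\<^sup>2) * multiplier s n)"
proof -
  let ?I = "{1..d}"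
  have fm: "(\<lambda>t. f t k) \<in> borel_measurable circle_measure" if "k \<in> ?I" for k
    using f that by (simp add: in_L2_def)
  have "\<exists>g. g \<in> borel_measurable borel \<and> (\<forall>x. g (x + 2 * pi) = g x) \<and> (AE x in circle_measure. f x k = g x)"
    if "k \<in> ?I" for k
    using borel_periodic_representative[OF fm[OF that]] by metis
  then obtain g where g: "\<And>k. k \<in> ?I \<Longrightarrow> g k \<in> borel_measurable borel"
      "\<And>k x. k \<in> ?I \<Longrightarrow> g k (x + 2 * pi) = g k x"
      "\<And>k. k \<in> ?I \<Longrightarrow> AE x in circle_measure. f x k = g k x" by metis
  \<comment> \<open>A single null set for all components, so that both integrals may be rewritten in turn.\<close>
  have ae: "AE x in circle_measure. \<forall>k\<in>?I. f x k = g k x"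
    using g(3) by (intro AE_finite_allI) auto
  have sq: "integrable circle_measure (\<lambda>t. (g k t)\<^sup>2)" if k: "k \<in> ?I" for k
  proof -
    have "integrable circle_measure (\<lambda>t. (f t k)\<^sup>2)"
    proof (rule Bochner_Integration.integrable_bound)
      show "integrable circle_measure (\<lambda>t. (L2_set (f t) ?I)\<^sup>2)" using f by (simp add: in_L2_def)
      show "(\<lambda>t. (f t k)\<^sup>2) \<in> borel_measurable circle_measure" using fm[OF k] by measurable
      have "(f t k)\<^sup>2 \<le> (\<Sum>i\<in>?I. (f t i)\<^sup>2)" for t using k by (intro member_le_sum) auto
      then show "AE t in circle_measure. norm ((f t k)\<^sup>2) \<le> norm ((L2_set (f t) ?I)\<^sup>2)"
        by (simp add: L2_set_squared sum_nonneg)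
    qed
    then show ?thesis
      using g(3)[OF k] by (subst integrable_cong_AE[symmetric, where f = "\<lambda>t. (f t k)\<^sup>2"])
        (use fm[OF k] borel_measurable_circle[OF g(1)[OF k]] in \<open>auto elim: eventually_mono\<close>)
  qed
  have coeff: "(LINT t|circle_measure. complex_of_real (g k t) * cis (real n * t)) = fourier_coeff f n k" if k: "k \<in> ?I" for n k
  proof -
    have cm: "(\<lambda>t. cis (real n * t)) \<in> borel_measurable circle_measure"
      by (intro borel_measurable_circle borel_measurable_continuous_onI continuous_intros)
    have "fourier_coeff f n k = (LINT t|circle_measure. complex_of_real (f t k) * cis (real n * t))"
      unfolding fourier_coeff_def by (simp add: cis_conv_exp mult_ac)
    also have "\<dots> = (LINT t|circle_measure. complex_of_real (g k t) * cis (real n * t))"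
      using fm[OF k] borel_measurable_circle[OF g(1)[OF k]] cm g(3)[OF k]
      by (intro integral_cong_AE) (auto elim: eventually_mono)
    finally show ?thesis by simp
  qed
  have "L_energy s d f = (\<integral>\<^sup>+v. \<integral>\<^sup>+u. (\<Sum>k\<in>?I. ennreal ((g k u - g k v)\<^sup>2 * log_kernel s (u - v))) \<partial>circle_measure \<partial>circle_measure)"
    unfolding L_energy_def
  proof (rule nn_integral_cong_AE, use ae in eventually_elim)
    case (elim v)
    show ?case
    proof (rule nn_integral_cong_AE, use ae in eventually_elim)
      case (elim u)
      have "(L2_set (\<lambda>k. f u k - f v k) ?I)\<^sup>2 = (\<Sum>k\<in>?I. (g k u - g k v)\<^sup>2)"
        using elim \<open>\<forall>k\<in>?I. f v k = g k v\<close> by (simp add: L2_set_squared)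
      then have "(L2_set (\<lambda>k. f u k - f v k) ?I)\<^sup>2 / \<bar>sin ((u - v) / 2)\<bar> * log 2 (pi / \<bar>sin ((u - v) / 2)\<bar>) powr (2 * s - 1)
          = (\<Sum>k\<in>?I. (g k u - g k v)\<^sup>2 * log_kernel s (u - v))"
        by (simp add: log_kernel_def sum_divide_distrib sum_distrib_right)
      then show ?case by (simp add: log_kernel_nonneg flip: sum_ennreal)
    qed
  qed
  also have "\<dots> = (\<integral>\<^sup>+v. (\<Sum>k\<in>?I. \<integral>\<^sup>+u. ennreal ((g k u - g k v)\<^sup>2 * log_kernel s (u - v)) \<partial>circle_measure) \<partial>circle_measure)"
  proof (intro nn_integral_cong nn_integral_sum borel_measurable_circle)
    fix v k assume "k \<in> ?I"
    note [measurable] = g(1)[OF this]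
    show "(\<lambda>u. ennreal ((g k u - g k v)\<^sup>2 * log_kernel s (u - v))) \<in> borel_measurable borel" by measurable
  qed
  also have "\<dots> = (\<Sum>k\<in>?I. \<integral>\<^sup>+v. \<integral>\<^sup>+u. ennreal ((g k u - g k v)\<^sup>2 * log_kernel s (u - v)) \<partial>circle_measure \<partial>circle_measure)"
  proof (rule nn_integral_sum)
    fix k assume "k \<in> ?I"
    note [measurable] = g(1)[OF this]
    show "(\<lambda>v. \<integral>\<^sup>+u. ennreal ((g k u - g k v)\<^sup>2 * log_kernel s (u - v)) \<partial>circle_measure) \<in> borel_measurable circle_measure"
      by (rule sigma_finite_measure.borel_measurable_nn_integral[OF finite_measure.axioms(1)[OF finite_measure_circle]],
        rule borel_measurable_circle_pair) measurable
  qed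
  also have "\<dots> = (\<Sum>k\<in>?I. \<Sum>n. ennreal (4 / pi * (cmod (fourier_coeff f n k))\<^sup>2) * multiplier s n)"
    by (intro sum.cong refl) (simp add: energy_eq_multiplier_sum[OF g(1) g(2) sq] coeff)
  also have "\<dots> = (\<Sum>n. \<Sum>k\<in>?I. ennreal (4 / pi * (cmod (fourier_coeff f n k))\<^sup>2) * multiplier s n)"
    by (rule suminf_sum[symmetric]) (rule summableI)
  also have "\<dots> = (\<Sum>n. ennreal (4 / pi * (L2_set (\<lambda>k. cmod (fourier_coeff f n k)) ?I)\<^sup>2) * multiplier s n)"
    by (simp add: L2_set_squared sum_distrib_left flip: sum_ennreal sum_distrib_right)
  finally show ?thesis .
qed

section \<open>Comparison of the two energies\<close>

lemma multiplier_zero: "multiplier s 0 = 0"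
  by (simp add: multiplier_def)

theorem theorem18:
  fixes s :: real
  assumes "0 < s"
  shows "\<exists>k K :: real. 0 < k \<and> k \<le> K \<and>
    (\<forall>d::nat. \<forall>f :: real \<Rightarrow> nat \<Rightarrow> real. d \<ge> 1 \<longrightarrow> in_L2 d f \<longrightarrow>
       ennreal k * l_energy s d f \<le> L_energy s d f \<and>
       L_energy s d f \<le> ennreal K * l_energy s d f)"
proof -
  obtain k where k: "0 < k" "\<And>n. n \<ge> 1 \<Longrightarrow> ennreal (k * log 2 (real n + 1) powr (2 * s)) \<le> multiplier s n"
    using multiplier_lower[OF assms] by blast
  obtain K where K: "0 < K" "\<And>n. n \<ge> 1 \<Longrightarrow> multiplier s n \<le> ennreal (K * log 2 (real n + 1) powr (2 * s))"
    using multiplier_upper[OF assms] by blast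
  let ?c = "\<lambda>d f n. L2_set (\<lambda>k. cmod (fourier_coeff f n k)) {1..d}"
  \<comment> \<open>Matches the two series term by term; the frequency \<open>n = 0\<close> contributes \<open>0\<close> to both.\<close>
  have scale: "ennreal (4 * b / pi) * ennreal (log 2 (real n + 1) powr (2 * s) * (?c d f n)\<^sup>2)
      = ennreal (4 / pi * (?c d f n)\<^sup>2) * ennreal (b * log 2 (real n + 1) powr (2 * s))" if "0 < b" for b d f n
    using that by (subst (1 2) ennreal_mult[symmetric]) (auto simp: mult_ac)
  have lower: "ennreal (4 * k / pi) * l_energy s d f \<le> L_energy s d f" if "in_L2 d f" for d f
    unfolding L_energy_eq_multiplier_sum[OF that] l_energy_def ennreal_suminf_cmult[symmetric] scale[OF k(1)]
  proof (intro suminf_le summableI mult_left_mono)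
    fix n show "ennreal (k * log 2 (real n + 1) powr (2 * s)) \<le> multiplier s n"
      using k(2)[of n] by (cases "n = 0") (auto simp: multiplier_zero)
  qed simp
  have upper: "L_energy s d f \<le> ennreal (4 * K / pi) * l_energy s d f" if "in_L2 d f" for d f
    unfolding L_energy_eq_multiplier_sum[OF that] l_energy_def ennreal_suminf_cmult[symmetric] scale[OF K(1)]
  proof (intro suminf_le summableI mult_left_mono)
    fix n show "multiplier s n \<le> ennreal (K * log 2 (real n + 1) powr (2 * s))"
      using K(2)[of n] by (cases "n = 0") (auto simp: multiplier_zero)
  qed simp
  show ?thesis
  proof (intro exI conjI allI impI)
    show "0 < 4 * k / pi" using k(1) by simp
    show "4 * k / pi \<le> max (4 * k / pi) (4 * K / pi)" by simp
    fix d :: nat and f :: "real \<Rightarrow> nat \<Rightarrow> real" assume f: "in_L2 d f"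
    show "ennreal (4 * k / pi) * l_energy s d f \<le> L_energy s d f" by (rule lower[OF f])
    have "L_energy s d f \<le> ennreal (4 * K / pi) * l_energy s d f" by (rule upper[OF f])
    also have "\<dots> \<le> ennreal (max (4 * k / pi) (4 * K / pi)) * l_energy s d f"
      by (intro mult_right_mono ennreal_leI) auto
    finally show "L_energy s d f \<le> ennreal (max (4 * k / pi) (4 * K / pi)) * l_energy s d f" .
  qed
qed

end
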